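(* Let $\Omega\subset\mathbb R^2$, $\mathcal T$, $\mathcal V$, $a=A\xi$, $b$ and $\psi$ be as in the context, with the mesh regularity condition, the standing assumptions (S), and the structure (A) with $g$ satisfying $s|g'(s)|\le C_g$ for all $s\ge0$. Let $u_1\in\mathcal V$ be a discrete subsolution and $u_2\in\mathcal V$ a discrete supersolution. Assume $$\lambda_0c_{min}-\Lambda_1C_f-\Lambda_2C_g>0,$$ and for each $T\in\mathcal T$ define $p_T^*:=\min\{\lambda_0c_T-\Lambda_1C_f-\Lambda_2C_g,\ \gamma_a/r_T\}$. If $$\min_{T\in\mathcal T}\left\{p_T^*-\delta_T(u_2)\frac{7K_\eta(1+r_T^{-1})}{6}-\frac{7B_\eta|T|s_T}{3}\right\}>0,$$ where $|T|$ is the area of $T$, then $u_1\le u_2$ in $\Omega$.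
   Context: Setting: $\Omega\subset\mathbb{R}^2$ polygonal, $\partial\Omega=\Gamma_D\cup\Gamma_N$ with $\Gamma_D$ of positive measure; $\mathcal{T}$ a conforming triangulation resolving $\Gamma_D,\Gamma_N$; $\mathcal{V}$ the continuous piecewise linear functions on $\mathcal T$ vanishing on $\Gamma_D$, $\mathcal V^+=\{v\in\mathcal V:v\ge0\}$. $\psi$ is a bounded measurable function on $\Gamma_N$. A discrete subsolution is $u_1\in\mathcal V$ with $\int_\Omega a(x,u_1,\nabla u_1)\cdot\nabla v+b(x,u_1)v\,dx-\int_{\Gamma_N}\psi v\,ds\le0$ for all $v\in\mathcal V^+$; a discrete supersolution $u_2\in\mathcal V$ satisfies the same with $\ge0$. Mesh regularity: there are $0<t_{min}\le t_{max}<\pi/2$ with every interior angle of every $T\in\mathcal T$ in $[t_{min},t_{max}]$; $c_{min}:=\cos(t_{max})$. For $T$ with angles $\theta_1,\theta_2,\theta_3$: $c_T:=\min_i\cos\theta_i$, $s_T:=\max_i\sin\theta_i$, $r_T:=\min_{i,j}\sin\theta_i/\sin\theta_j$. For $\phi\in\mathcal V$, $\delta_T(\phi):=\max_{i,j}|\phi(a_i)-\phi(a_j)|$ over the vertices $a_1,a_2,a_3$ of $T$. (S) $a(x,\eta,\xi)=A(x,\eta,\xi)\xi$ with $A:\Omega\times\mathbb R\times\mathbb R^2\to\mathbb R$; $a$ and $b(x,\eta)$ Carathéodory, $C^1$ in $(\eta,\xi)$ (resp. $\eta$) for a.e. $x$, measurable in $x$; there are $\gamma_a>0,K_\eta>0,B_\eta\ge0$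 with, for a.e. $x$ and all $\eta,\xi,\zeta$: $\sum_{i,j}\frac{\partial a_i}{\partial\xi_j}(x,\eta,\xi)\zeta_i\zeta_j\ge\gamma_a|\zeta|^2$, $|\partial A/\partial\eta|\le K_\eta$, $0\le\partial b/\partial\eta\le B_\eta$. (A) $A(x,\eta,\xi)=A_0(x,\eta)+A_1(x,\eta)f(|\xi|)+A_2(x)g(|\xi|)$ with constants $\lambda_0>0$, $\Lambda_1,\Lambda_2\ge0$ such that $A_0\ge\lambda_0$, $0\le A_1\le\Lambda_1$, $0\le A_2\le\Lambda_2$ for a.e. $x$ and all $\eta$; $f,g\ge0$ and $s|f'(s)|\le C_f$ for all $s\ge0$. *)

theory Defs
  imports "HOL-Analysis.Analysis"
begin

type_synonym pt = "real^2"

text \<open>A triangle is represented by its set of three (affinely independent) vertices;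
  the closed triangle is its convex hull.\<close>

definition is_triangle :: "pt set \<Rightarrow> bool" where
  "is_triangle V \<longleftrightarrow> card V = 3 \<and> \<not> collinear V"

definition vertex_angle :: "pt \<Rightarrow> pt \<Rightarrow> pt \<Rightarrow> real" where
  "vertex_angle p q r = arccos (((q - p) \<bullet> (r - p)) / (norm (q - p) * norm (r - p)))"

definition angle_of :: "pt set \<Rightarrow> pt \<Rightarrow> real" where
  "angle_of V p = (THE \<theta>. \<exists>q r. V = {p, q, r} \<and> q \<noteq> r \<and> p \<noteq> q \<and> p \<noteq> r \<and> \<theta> = vertex_angle p q r)"

definition c_T :: "pt set \<Rightarrow> real" where
  "c_T V = Min ((\<lambda>p. cos (angle_of V p)) ` V)"

definition s_T :: "pt set \<Rightarrow> real" where
  "s_T V = Max ((\<lambda>p. sin (angle_of V p)) ` V)"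

definition r_T :: "pt set \<Rightarrow> real" where
  "r_T V = Min ((\<lambda>(p, q). sin (angle_of V p) / sin (angle_of V q)) ` (V \<times> V))"

definition delta_T :: "pt set \<Rightarrow> (pt \<Rightarrow> real) \<Rightarrow> real" where
  "delta_T V \<phi> = Max ((\<lambda>(p, q). \<bar>\<phi> p - \<phi> q\<bar>) ` (V \<times> V))"

definition area_T :: "pt set \<Rightarrow> real" where
  "area_T V = measure lebesgue (convex hull V)"

definition conforming :: "pt set set \<Rightarrow> bool" where
  "conforming \<T> \<longleftrightarrow> finite \<T> \<and> (\<forall>V\<in>\<T>. is_triangle V) \<and>
     (\<forall>V\<in>\<T>. \<forall>W\<in>\<T>. V \<noteq> W \<longrightarrow> convex hull V \<inter> convex hull W = convex hull (V \<inter> W))"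

definition triangulates :: "pt set set \<Rightarrow> pt set \<Rightarrow> bool" where
  "triangulates \<T> \<Omega> \<longleftrightarrow> conforming \<T> \<and> \<Omega> = interior (\<Union>V\<in>\<T>. convex hull V)"

definition boundary_edges :: "pt set set \<Rightarrow> pt set \<Rightarrow> pt set set" where
  "boundary_edges \<T> \<Omega> = {e. card e = 2 \<and> (\<exists>V\<in>\<T>. e \<subseteq> V) \<and> convex hull e \<subseteq> frontier \<Omega>}"

text \<open>The Dirichlet part: union of the Dirichlet edges; the Neumann part is the rest of the
  boundary (so the mesh resolves both parts).\<close>
definition Gamma :: "pt set set \<Rightarrow> pt set" where
  "Gamma E = (\<Union>e\<in>E. convex hull e)"

definition edge_integral :: "(pt \<Rightarrow> real) \<Rightarrow> pt set \<Rightarrow> real" where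
  "edge_integral h e = (let (p, q) = (SOME (p, q). e = {p, q} \<and> p \<noteq> q) in
      dist p q * integral {0..1::real} (\<lambda>t. h (p + t *\<^sub>R (q - p))))"

definition P1_space :: "pt set set \<Rightarrow> pt set \<Rightarrow> pt set \<Rightarrow> (pt \<Rightarrow> real) set" where
  "P1_space \<T> \<Omega> \<Gamma>D = {u. continuous_on (closure \<Omega>) u \<and>
      (\<forall>V\<in>\<T>. \<exists>w c. \<forall>x\<in>convex hull V. u x = w \<bullet> x + c) \<and> (\<forall>x\<in>\<Gamma>D. u x = 0)}"

definition P1_plus :: "pt set set \<Rightarrow> pt set \<Rightarrow> pt set \<Rightarrow> (pt \<Rightarrow> real) set" where
  "P1_plus \<T> \<Omega> \<Gamma>D = {v\<in>P1_space \<T> \<Omega> \<Gamma>D. \<forall>x\<in>closure \<Omega>. 0 \<le> v x}"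

text \<open>Gradient (defined almost everywhere, namely wherever u is differentiable).\<close>
definition grad :: "(pt \<Rightarrow> real) \<Rightarrow> pt \<Rightarrow> pt" where
  "grad u x = (SOME w. (u has_derivative (\<lambda>h. w \<bullet> h)) (at x))"

definition residual ::
  "pt set \<Rightarrow> pt set set \<Rightarrow> (pt \<Rightarrow> real \<Rightarrow> pt \<Rightarrow> pt) \<Rightarrow> (pt \<Rightarrow> real \<Rightarrow> real) \<Rightarrow>
   (pt \<Rightarrow> real) \<Rightarrow> (pt \<Rightarrow> real) \<Rightarrow> (pt \<Rightarrow> real) \<Rightarrow> real" where
  "residual \<Omega> EN a b \<psi> u v =
     (\<integral>x\<in>\<Omega>. (a x (u x) (grad u x) \<bullet> grad v x + b x (u x) * v x) \<partial>lebesgue)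
     - (\<Sum>e\<in>EN. edge_integral (\<lambda>y. \<psi> y * v y) e)"

definition residual_integrable ::
  "pt set \<Rightarrow> (pt \<Rightarrow> real \<Rightarrow> pt \<Rightarrow> pt) \<Rightarrow> (pt \<Rightarrow> real \<Rightarrow> real) \<Rightarrow>
   (pt \<Rightarrow> real) \<Rightarrow> (pt \<Rightarrow> real) \<Rightarrow> bool" where
  "residual_integrable \<Omega> a b u v \<longleftrightarrow>
     set_integrable lebesgue \<Omega> (\<lambda>x. a x (u x) (grad u x) \<bullet> grad v x + b x (u x) * v x)"

definition discrete_subsolution where
  "discrete_subsolution \<T> \<Omega> ED a b \<psi> u \<longleftrightarrow> u \<in> P1_space \<T> \<Omega> (Gamma ED) \<and>
     (\<forall>v\<in>P1_plus \<T> \<Omega> (Gamma ED). residual_integrable \<Omega> a b u v \<and>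
        residual \<Omega> (boundary_edges \<T> \<Omega> - ED) a b \<psi> u v \<le> 0)"

definition discrete_supersolution where
  "discrete_supersolution \<T> \<Omega> ED a b \<psi> u \<longleftrightarrow> u \<in> P1_space \<T> \<Omega> (Gamma ED) \<and>
     (\<forall>v\<in>P1_plus \<T> \<Omega> (Gamma ED). residual_integrable \<Omega> a b u v \<and>
        residual \<Omega> (boundary_edges \<T> \<Omega> - ED) a b \<psi> u v \<ge> 0)"

definition C1_fun :: "('a::real_normed_vector \<Rightarrow> 'b::real_normed_vector) \<Rightarrow> bool" where
  "C1_fun f \<longleftrightarrow> (\<exists>D. (\<forall>z. (f has_derivative blinfun_apply (D z)) (at z)) \<and> continuous_on UNIV D)"

end

theory Submission
  imports Defs
begin

text \<open>
  Test the difference of the two inequalities with the piecewise linear \<open>v\<close> that is \<open>1\<close> at the nodes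
  where \<open>u\<^sub>1 > u\<^sub>2\<close> and \<open>0\<close> at the others. On a triangle where all three nodes are of the same kind
  \<open>v\<close> is constant and the integrand is nonnegative by monotonicity of \<open>b\<close>. On a mixed triangle
  \<open>\<nabla>v\<close> is up to sign the gradient of the barycentric coordinate of the odd node, and
  \<open>\<nabla>(u\<^sub>1 - u\<^sub>2)\<close> is a combination of the other two barycentric gradients with coefficients of a definite
  sign. These gradients meet \<open>\<nabla>v\<close> at an acute angle, so the diffusion term is bounded below via the mean
  value theorem, and since \<open>\<bar>u\<^sub>1 - u\<^sub>2\<bar>\<close> is at most the larger nodal jump, the perturbations from
  the \<open>\<eta>\<close>-dependence of \<open>A\<close> and \<open>b\<close> can be absorbed pointwise, with constants \<open>1\<close> and \<open>2\<close> in place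
  of \<open>7/6\<close> and \<open>7/3\<close>. The integrand is thus strictly positive on mixed triangles, so there are none;
  then \<open>v\<close> is a continuous \<open>{0, 1}\<close>-valued function on a connected set vanishing on the Dirichlet edges.
\<close>

section \<open>Radial fluxes: differentiability and a lower bound for increments\<close>

text \<open>Away from the origin this is the chain rule. At the origin it follows from right
  continuity of \<open>F\<close> at \<open>0\<close>, since the error of the difference quotient has
  norm \<open>\<bar>F (norm h) - F 0\<bar>\<close>; the term with \<open>F'\<close> vanishes there
  through its factor \<open>\<xi>\<close>.\<close>

lemma radial_has_derivative:
  fixes F F' :: "real \<Rightarrow> real" and \<xi> :: "'a::real_inner"
  assumes F: "\<And>s. s \<ge> 0 \<Longrightarrow> (F has_real_derivative F' s) (at s within {0..})"
  shows "((\<lambda>\<xi>. F (norm \<xi>) *\<^sub>R \<xi>) has_derivative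
           (\<lambda>\<zeta>. F (norm \<xi>) *\<^sub>R \<zeta> + (F' (norm \<xi>) * (sgn \<xi> \<bullet> \<zeta>)) *\<^sub>R \<xi>)) (at \<xi>)"
proof (cases "\<xi> = 0")
  case False
  have int: "norm \<xi> \<in> interior {0::real..}"
    using False by simp
  have "(F has_real_derivative F' (norm \<xi>)) (at (norm \<xi>))"
    using F[of "norm \<xi>"] at_within_interior[OF int] by simp
  then have "((\<lambda>\<xi>. F (norm \<xi>)) has_derivative (\<lambda>\<zeta>. (sgn \<xi> \<bullet> \<zeta>) * F' (norm \<xi>))) (at \<xi>)"
    using has_derivative_compose[OF has_derivative_norm[OF False], of F "(*) (F' (norm \<xi>))"]
    by (simp add: has_field_derivative_def inner_commute mult.commute)
  then show ?thesis
    by (auto intro!: derivative_eq_intros simp: mult.commute)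
next
  case True
  have "continuous (at 0 within {0..}) F"
    using F[of 0] by (auto intro: DERIV_continuous)
  then have "(F \<longlongrightarrow> F 0) (at 0 within {0..})"
    by (simp add: continuous_within)
  moreover have "filterlim (norm :: 'a \<Rightarrow> real) (at 0 within {0..}) (at 0)"
    by (auto simp: filterlim_at eventually_at_filter intro!: tendsto_norm_zero)
  ultimately have "((\<lambda>h::'a. F (norm h)) \<longlongrightarrow> F 0) (at 0)"
    by (rule filterlim_compose)
  then have "((\<lambda>h::'a. \<bar>F (norm h) - F 0\<bar>) \<longlongrightarrow> 0) (at 0)"
    by (auto intro: tendsto_rabs_zero simp: LIM_zero_iff)
  moreover have "\<forall>\<^sub>F h::'a in at 0. \<bar>F (norm h) - F 0\<bar> =
      norm (F (norm h) *\<^sub>R h - F 0 *\<^sub>R h) / norm h"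
    by (auto simp: eventually_at_filter simp flip: scaleR_left_diff_distrib)
  ultimately have "((\<lambda>h::'a. norm (F (norm h) *\<^sub>R h - F 0 *\<^sub>R h) / norm h) \<longlongrightarrow> 0) (at 0)"
    using tendsto_cong by fastforce
  then show ?thesis
    using True by (simp add: has_derivative_at bounded_linear_scaleR_right)
qed

text \<open>The mean value theorem along the segment from \<open>\<xi>\<^sub>2\<close> to
  \<open>\<xi>\<^sub>1\<close> reduces the increment to the derivative of the flux, which is linear
  in its direction. In each of the directions \<open>\<zeta>\<^sub>1\<close>,
  \<open>\<zeta>\<^sub>2\<close> the part with \<open>F\<close> is bounded below by the angle
  condition, the part with \<open>F'\<close> by Cauchy-Schwarz.\<close>

lemma radial_flux_diff_ge:
  fixes F F' :: "real \<Rightarrow> real" and \<xi>\<^sub>1 \<xi>\<^sub>2 z \<zeta>\<^sub>1 \<zeta>\<^sub>2 :: "'a::real_inner"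
  assumes F: "\<And>s. s \<ge> 0 \<Longrightarrow> (F has_real_derivative F' s) (at s within {0..})"
    and F_ge: "\<And>s. s \<ge> 0 \<Longrightarrow> F s \<ge> l" and F'_le: "\<And>s. s \<ge> 0 \<Longrightarrow> s * \<bar>F' s\<bar> \<le> C"
    and diff: "\<xi>\<^sub>1 - \<xi>\<^sub>2 = d\<^sub>1 *\<^sub>R \<zeta>\<^sub>1 + d\<^sub>2 *\<^sub>R \<zeta>\<^sub>2" and d: "d\<^sub>1 \<ge> 0" "d\<^sub>2 \<ge> 0"
    and angle: "z \<bullet> \<zeta>\<^sub>1 \<ge> c * (norm z * norm \<zeta>\<^sub>1)" "z \<bullet> \<zeta>\<^sub>2 \<ge> c * (norm z * norm \<zeta>\<^sub>2)"
    and c: "c \<ge> 0" and l: "l \<ge> 0"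
  shows "z \<bullet> (F (norm \<xi>\<^sub>1) *\<^sub>R \<xi>\<^sub>1 - F (norm \<xi>\<^sub>2) *\<^sub>R \<xi>\<^sub>2)
    \<ge> (l * c - C) * norm z * (d\<^sub>1 * norm \<zeta>\<^sub>1 + d\<^sub>2 * norm \<zeta>\<^sub>2)"
proof -
  define X where "X s = \<xi>\<^sub>2 + s *\<^sub>R (\<xi>\<^sub>1 - \<xi>\<^sub>2)" for s :: real
  define G where "G s \<zeta> = F (norm (X s)) *\<^sub>R \<zeta> + (F' (norm (X s)) * (sgn (X s) \<bullet> \<zeta>)) *\<^sub>R X s" for s \<zeta>
  have "((\<lambda>s. z \<bullet> (F (norm (X s)) *\<^sub>R X s)) has_derivative (\<lambda>h. h * (z \<bullet> G s (\<xi>\<^sub>1 - \<xi>\<^sub>2)))) (at s)" for s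
  proof -
    have X: "(X has_derivative (\<lambda>h. h *\<^sub>R (\<xi>\<^sub>1 - \<xi>\<^sub>2))) (at s)"
      unfolding X_def by (auto intro!: derivative_eq_intros)
    have "((\<lambda>s. F (norm (X s)) *\<^sub>R X s) has_derivative (\<lambda>h. G s (h *\<^sub>R (\<xi>\<^sub>1 - \<xi>\<^sub>2)))) (at s)"
      unfolding G_def
      by (rule has_derivative_compose[OF X radial_has_derivative[OF F], unfolded o_def])
    then have "((\<lambda>s. z \<bullet> (F (norm (X s)) *\<^sub>R X s)) has_derivative (\<lambda>h. z \<bullet> G s (h *\<^sub>R (\<xi>\<^sub>1 - \<xi>\<^sub>2)))) (at s)"
      by (rule has_derivative_inner_right)
    then show ?thesis
      by (simp add: G_def algebra_simps inner_simps)
  qed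
  then obtain s where s: "z \<bullet> (F (norm (X 1)) *\<^sub>R X 1) - z \<bullet> (F (norm (X 0)) *\<^sub>R X 0)
      = z \<bullet> G s (\<xi>\<^sub>1 - \<xi>\<^sub>2)"
    using mvt_simple[of 0 1 "\<lambda>s. z \<bullet> (F (norm (X s)) *\<^sub>R X s)" "\<lambda>s h. h * (z \<bullet> G s (\<xi>\<^sub>1 - \<xi>\<^sub>2))"]
    by (auto intro: has_derivative_at_withinI)
  \<comment> \<open>A single direction is treated here, because the angle condition is given for
    \<open>\<zeta>\<^sub>1\<close> and \<open>\<zeta>\<^sub>2\<close> separately.\<close>
  have G_ge: "z \<bullet> G s \<zeta> \<ge> (l * c - C) * (norm z * norm \<zeta>)"
    if "z \<bullet> \<zeta> \<ge> c * (norm z * norm \<zeta>)" for \<zeta>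
  proof -
    let ?N = "norm z * norm \<zeta>"
    have N: "?N \<ge> 0" by simp
    have "l * (c * ?N) \<le> F (norm (X s)) * (z \<bullet> \<zeta>)"
      using that F_ge[of "norm (X s)"] l c N by (intro mult_mono) auto
    moreover have "\<bar>F' (norm (X s)) * (sgn (X s) \<bullet> \<zeta>) * (z \<bullet> X s)\<bar> \<le> C * ?N"
    proof -
      have "\<bar>sgn (X s) \<bullet> \<zeta>\<bar> \<le> norm (sgn (X s)) * norm \<zeta>"
        by (rule Cauchy_Schwarz_ineq2)
      also have "\<dots> \<le> norm \<zeta>"
        by (simp add: norm_sgn)
      finally have "\<bar>F' (norm (X s)) * (sgn (X s) \<bullet> \<zeta>) * (z \<bullet> X s)\<bar>
          \<le> \<bar>F' (norm (X s))\<bar> * norm \<zeta> * (norm z * norm (X s))"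
        unfolding abs_mult
        by (intro mult_mono Cauchy_Schwarz_ineq2 mult_nonneg_nonneg) auto
      \<comment> \<open>The factor \<open>norm (X s)\<close> coming from
        \<open>z \<bullet> X s\<close> supplies the weight \<open>s\<close> in the bound on
        \<open>F'\<close>.\<close>
      also have "\<dots> = (norm (X s) * \<bar>F' (norm (X s))\<bar>) * ?N"
        by (simp add: mult_ac)
      also have "\<dots> \<le> C * ?N"
        using N F'_le[of "norm (X s)"] by (intro mult_right_mono) auto
      finally show ?thesis .
    qed
    ultimately show ?thesis
      unfolding G_def by (simp add: inner_simps algebra_simps)
  qed
  have "z \<bullet> G s (\<xi>\<^sub>1 - \<xi>\<^sub>2) = d\<^sub>1 * (z \<bullet> G s \<zeta>\<^sub>1) + d\<^sub>2 * (z \<bullet> G s \<zeta>\<^sub>2)"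
    unfolding diff by (simp add: G_def inner_simps algebra_simps)
  also have "\<dots> \<ge> d\<^sub>1 * ((l * c - C) * (norm z * norm \<zeta>\<^sub>1)) + d\<^sub>2 * ((l * c - C) * (norm z * norm \<zeta>\<^sub>2))"
    using d angle by (intro add_mono mult_left_mono G_ge)
  finally show ?thesis
    using s by (simp add: X_def inner_simps algebra_simps)
qed

section \<open>Barycentric gradients, angles and area of a triangle\<close>

text \<open>Twice the signed area of the triangle.\<close>

definition tri_det :: "pt \<Rightarrow> pt \<Rightarrow> pt \<Rightarrow> real" where
  "tri_det p q r = (q$1 - p$1) * (r$2 - p$2) - (r$1 - p$1) * (q$2 - p$2)"

text \<open>The gradient of the barycentric coordinate belonging to \<open>p\<close> in the triangle \<open>p, q, r\<close>.\<close>
definition hat_grad :: "pt \<Rightarrow> pt \<Rightarrow> pt \<Rightarrow> pt" where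
  "hat_grad p q r = (1 / tri_det p q r) *\<^sub>R vector [q$2 - r$2, r$1 - q$1]"

lemma tri_det_swap: "tri_det p r q = - tri_det p q r"
  and tri_det_rotate: "tri_det q r p = tri_det p q r"
  by (simp_all add: tri_det_def algebra_simps)

lemma hat_grad_swap: "hat_grad p r q = hat_grad p q r"
  unfolding hat_grad_def tri_det_swap[of p r q]
  by (simp add: vec_eq_iff forall_2 vector_2 diff_divide_distrib)

text \<open>If the determinant vanishes and \<open>q \<noteq> p\<close>, then \<open>r - p\<close>
  equals its own orthogonal projection onto the line spanned by \<open>q - p\<close>.\<close>

lemma tri_det_nonzero:
  assumes "\<not> collinear {p, q, r}"
  shows "tri_det p q r \<noteq> 0"
proof
  assume D: "tri_det p q r = 0"
  show False
  proof (cases "q = p")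
    case False
    then have N: "(q - p) \<bullet> (q - p) \<noteq> 0"
      by simp
    have "((q - p) \<bullet> (q - p)) *\<^sub>R (r - p) = ((q - p) \<bullet> (r - p)) *\<^sub>R (q - p)"
      using D unfolding tri_det_def vec_eq_iff forall_2 by (simp add: inner_vec_def sum_2) algebra
    then have "(r - p) = (((q - p) \<bullet> (r - p)) / ((q - p) \<bullet> (q - p))) *\<^sub>R (q - p)"
      using N by (metis (no_types, lifting) divide_inverse_commute scaleR_one scaleR_scaleR left_inverse)
    then have "collinear {0, q - p, r - p}"
      using collinear_lemma by blast
    then have "collinear {q, p, r}"
      by (subst collinear_3) auto
    then show False
      using assms by (simp add: insert_commute)
  qed (use assms in simp)
qed

text \<open>The two barycentric gradients are the dual basis of the edge vectors
  \<open>q - p\<close> and \<open>r - p\<close>, so the gradient of an affine function is recovered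
  from its nodal differences. The computation is Cramer's rule.\<close>

lemma hat_grad_decomposition:
  assumes "tri_det p q r \<noteq> 0"
  shows "w = (w \<bullet> (q - p)) *\<^sub>R hat_grad q r p + (w \<bullet> (r - p)) *\<^sub>R hat_grad r p q" (is "w = ?rhs")
proof -
  have "tri_det p q r *\<^sub>R w = (w \<bullet> (q - p)) *\<^sub>R vector [r$2 - p$2, p$1 - r$1]
      + (w \<bullet> (r - p)) *\<^sub>R vector [p$2 - q$2, q$1 - p$1]"
    by (simp add: vec_eq_iff forall_2 inner_vec_def sum_2 vector_2 tri_det_def algebra_simps)
  then have "(1 / tri_det p q r) *\<^sub>R (tri_det p q r *\<^sub>R w) = ?rhs"
    unfolding hat_grad_def tri_det_rotate[of q r p] tri_det_rotate[of r p q]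
    by (simp add: scaleR_add_right mult.commute)
  then show ?thesis
    using assms by simp
qed

lemma hat_grad_inner_vertex:
  assumes "tri_det p q r \<noteq> 0"
  shows "hat_grad p q r \<bullet> (p - q) = 1" "hat_grad p q r \<bullet> (p - r) = 1" "hat_grad p q r \<bullet> (q - r) = 0"
  using assms unfolding hat_grad_def
    by (simp_all add: inner_vec_def sum_2 vector_2 divide_simps)  (simp_all add: tri_det_def algebra_simps)

text \<open>Barycentric coordinates add up to \<open>1\<close>, hence their gradients add up to
  zero.\<close>

lemma hat_grad_sum: "tri_det p q r \<noteq> 0 \<Longrightarrow> hat_grad q r p + hat_grad r p q = - hat_grad p q r"
  unfolding hat_grad_def tri_det_rotate[of q r p] tri_det_rotate[of r p q]
  by (simp add: vec_eq_iff forall_2 vector_2 divide_simps)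

text \<open>This is the reciprocal of the height of \<open>p\<close> over the opposite side.\<close>

lemma norm_hat_grad: "norm (hat_grad p q r) = dist q r / \<bar>tri_det p q r\<bar>"
  unfolding hat_grad_def
  by (simp add: norm_vec_def dist_vec_def dist_real_def L2_set_def sum_2 vector_2 power_divide power2_commute[of "r$1"] add.commute
      real_sqrt_divide flip: add_divide_distrib)

text \<open>Each barycentric gradient is the opposite edge turned by a right angle and divided by
  the determinant, so the inner product is that of two edges.\<close>

lemma hat_grad_inner_hat_grad:
  "hat_grad p q r \<bullet> hat_grad q r p = - ((p - r) \<bullet> (q - r)) / (tri_det p q r)\<^sup>2"
  unfolding hat_grad_def tri_det_rotate[of q r p] tri_det_rotate[of r p q]
  by (simp add: inner_vec_def sum_2 vector_2 power2_eq_square divide_simps) algebra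

text \<open>Pythagoras for sine and cosine of the angle at \<open>p\<close>, cleared of
  denominators; it yields the sine from the cosine.\<close>

lemma tri_det_Lagrange: "(tri_det p q r)\<^sup>2 + ((q - p) \<bullet> (r - p))\<^sup>2 = (norm (q - p) * norm (r - p))\<^sup>2"
  unfolding power_mult_distrib power2_norm_eq_inner tri_det_def
  by (simp add: inner_vec_def sum_2 power2_eq_square algebra_simps)

lemma abs_inner_divide_norms_le: "\<bar>(x \<bullet> y) / (norm x * norm y)\<bar> \<le> 1"
  \<comment> \<open>For a zero vector the quotient is \<open>0\<close> by the convention on division
    by zero.\<close>
  using Cauchy_Schwarz_ineq2[of x y]
  by (cases "x = 0 \<or> y = 0") (auto simp: abs_mult)

lemma cos_vertex_angle:
  "cos (vertex_angle p q r) = ((q - p) \<bullet> (r - p)) / (norm (q - p) * norm (r - p))"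
  unfolding vertex_angle_def
  by (intro cos_arccos_abs abs_inner_divide_norms_le)

lemma sin_vertex_angle:
  assumes "tri_det p q r \<noteq> 0"
  shows "sin (vertex_angle p q r) = \<bar>tri_det p q r\<bar> / (norm (q - p) * norm (r - p))"
proof -
  let ?N = "norm (q - p) * norm (r - p)"
  let ?t = "((q - p) \<bullet> (r - p)) / ?N"
  have "q \<noteq> p" "r \<noteq> p"
    using assms by (auto simp: tri_det_def)
  then have N: "?N > 0"
    by simp
  have "sin (vertex_angle p q r) = sqrt (1 - ?t\<^sup>2)"
    unfolding vertex_angle_def by (intro sin_arccos_abs abs_inner_divide_norms_le)
  also have "1 - ?t\<^sup>2 = (\<bar>tri_det p q r\<bar> / ?N)\<^sup>2"
  proof -
    have "(\<bar>tri_det p q r\<bar> / ?N)\<^sup>2 = (?N\<^sup>2 - ((q - p) \<bullet> (r - p))\<^sup>2) / ?N\<^sup>2"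
      unfolding power_divide tri_det_Lagrange[of p q r, symmetric] by simp
    also have "\<dots> = 1 - ?t\<^sup>2"
      using \<open>q \<noteq> p\<close> \<open>r \<noteq> p\<close> by (simp add: diff_divide_distrib power_divide)
    finally show ?thesis by simp
  qed
  also have "sqrt \<dots> = \<bar>tri_det p q r\<bar> / ?N"
    by (subst real_sqrt_abs) simp
  finally show ?thesis .
qed

lemma vertex_angle_swap: "vertex_angle p r q = vertex_angle p q r"
  by (simp add: vertex_angle_def inner_commute mult.commute)

text \<open>The definite description is legitimate: the other two vertices are determined up to
  order, and \<open>vertex_angle\<close> is symmetric in them.\<close>

lemma angle_of_triangle:
  assumes "p \<noteq> q" "p \<noteq> r" "q \<noteq> r"
  shows "angle_of {p, q, r} p = vertex_angle p q r"
  unfolding angle_of_def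
proof (rule the_equality)
  show "\<exists>q' r'. {p, q, r} = {p, q', r'} \<and> q' \<noteq> r' \<and> p \<noteq> q' \<and> p \<noteq> r' \<and> vertex_angle p q r = vertex_angle p q' r'"
    using assms by blast
next
  fix \<theta> assume "\<exists>q' r'. {p, q, r} = {p, q', r'} \<and> q' \<noteq> r' \<and> p \<noteq> q' \<and> p \<noteq> r' \<and> \<theta> = vertex_angle p q' r'"
  then obtain q' r' where *: "{p, q, r} = {p, q', r'}" "q' \<noteq> r'" "p \<noteq> q'" "p \<noteq> r'" "\<theta> = vertex_angle p q' r'"
    by blast
  have "{q, r} = {q', r'}"
    using *(1-4) assms by (metis Diff_insert_absorb insertE singletonD)
  then show "\<theta> = vertex_angle p q r"
    using *(5) vertex_angle_swap by (auto simp: doubleton_eq_iff)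
qed

lemma area_T_triangle: "area_T {p, q, r} = \<bar>tri_det p q r\<bar> / 2"
proof -
  have "area_T {p, q, r} = measure lborel (convex hull {p, q, r})"
    unfolding area_T_def
    by (intro measure_completion) (auto intro!: borel_closed compact_imp_closed compact_convex_hull)
  also have "\<dots> = \<bar>tri_det p q r\<bar> / 2"
    unfolding content_triangle tri_det_def by (simp add: algebra_simps abs_minus_commute)
  finally show ?thesis .
qed

lemma is_triangleD:
  assumes "is_triangle {p, q, r}"
  shows "p \<noteq> q" "p \<noteq> r" "q \<noteq> r" "tri_det p q r \<noteq> 0"
  using assms tri_det_nonzero[of p q r] by (auto simp: is_triangle_def card_insert_if split: if_splits)

lemma is_triangleE:
  assumes "is_triangle V" "p \<in> V"
  obtains q r where "V = {p, q, r}"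
proof -
  have "card (V - {p}) = 2"
    using assms by (simp add: is_triangle_def card_Diff_singleton)
  then obtain q r where "V - {p} = {q, r}"
    by (auto simp: card_2_iff)
  then show ?thesis
    using that[of q r] assms(2) by blast
qed

lemma is_triangle_finite: "is_triangle V \<Longrightarrow> finite V" "is_triangle V \<Longrightarrow> V \<noteq> {}"
  unfolding is_triangle_def by (auto intro: card_ge_0_finite)

lemma sin_angle_of:
  assumes "is_triangle {p, q, r}"
  shows "sin (angle_of {p, q, r} p) = \<bar>tri_det p q r\<bar> / (dist p q * dist p r)"
  using is_triangleD[OF assms]
  by (simp add: angle_of_triangle sin_vertex_angle dist_norm norm_minus_commute)

lemma norm_hat_grad_pos:
  assumes "is_triangle {p, q, r}"
  shows "norm (hat_grad p q r) > 0"
  using is_triangleD[OF assms] by (simp add: norm_hat_grad)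

text \<open>Since gradients are rotated edges, one gradient and the negative of another enclose the
  interior angle at the third vertex. This turns bounds on the angles into the angle condition of
  \<open>radial_flux_diff_ge\<close>.\<close>

lemma hat_grad_inner_eq_cos:
  assumes "is_triangle {p, q, r}"
  shows "hat_grad p q r \<bullet> - hat_grad q r p =
    cos (angle_of {p, q, r} r) * (norm (hat_grad p q r) * norm (hat_grad q r p))"
proof -
  have *: "angle_of {p, q, r} r = vertex_angle r p q"
    using is_triangleD[OF assms] angle_of_triangle[of r p q] by (simp add: insert_commute)
  show ?thesis
    using is_triangleD[OF assms]
    unfolding * cos_vertex_angle norm_hat_grad inner_minus_right hat_grad_inner_hat_grad tri_det_rotate[of q r p]
    by (simp add: dist_norm norm_minus_commute power2_eq_square abs_if)
qed

text \<open>A scaling identity: it rewrites a nodal jump as jump times gradient norms times area,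
  the form in which the term with \<open>b\<close> is compared with the diffusion term.\<close>

lemma norm_hat_grad_times_sin:
  assumes "is_triangle {p, q, r}"
  shows "norm (hat_grad p q r) * norm (hat_grad q r p) * (2 * area_T {p, q, r}) * sin (angle_of {p, q, r} r) = 1"
proof -
  have "sin (angle_of {p, q, r} r) = \<bar>tri_det p q r\<bar> / (dist p r * dist q r)"
    using sin_angle_of[of r p q] assms tri_det_rotate[of r p q] tri_det_rotate[of q r p]
    by (simp add: insert_commute dist_commute)
  then show ?thesis
    using is_triangleD[OF assms]
    unfolding norm_hat_grad area_T_triangle tri_det_rotate[of q r p]
    by (simp add: dist_commute)
qed

lemma sin_angle_of_pos: "is_triangle V \<Longrightarrow> p \<in> V \<Longrightarrow> sin (angle_of V p) > 0"
  by (metis is_triangleE is_triangleD sin_angle_of zero_less_abs_iff zero_less_dist_iff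
      zero_less_divide_iff zero_less_mult_iff)

lemma r_T_pos:
  assumes "is_triangle V"
  shows "r_T V > 0"
  using is_triangle_finite[OF assms] sin_angle_of_pos[OF assms] unfolding r_T_def
  by (subst Min_gr_iff) auto

text \<open>Gradient norms are proportional to the opposite sides, hence by the law of sines to the
  sines of the angles.\<close>

lemma norm_hat_grad_le_r_T:
  assumes "is_triangle {p, q, r}"
  shows "norm (hat_grad q r p) \<le> norm (hat_grad p q r) / r_T {p, q, r}"
proof -
  have tri': "is_triangle {q, r, p}"
    using assms by (simp add: insert_commute)
  have "r_T {p, q, r} \<le> sin (angle_of {p, q, r} p) / sin (angle_of {p, q, r} q)"
    unfolding r_T_def by (rule Min_le) auto
  also have "\<dots> = norm (hat_grad p q r) / norm (hat_grad q r p)"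
    using is_triangleD[OF assms] sin_angle_of[OF assms] sin_angle_of[OF tri'] tri_det_rotate[of q r p]
    by (simp add: norm_hat_grad dist_commute insert_commute)
  finally show ?thesis
    using norm_hat_grad_pos[OF tri'] r_T_pos[OF assms] by (simp add: field_simps)
qed

lemma c_T_le: "is_triangle V \<Longrightarrow> p \<in> V \<Longrightarrow> c_T V \<le> cos (angle_of V p)"
  using is_triangle_finite[of V] by (auto simp: c_T_def)

lemma s_T_ge: "is_triangle V \<Longrightarrow> p \<in> V \<Longrightarrow> sin (angle_of V p) \<le> s_T V"
  using is_triangle_finite[of V] by (auto simp: s_T_def)

lemma c_T_ge: "is_triangle V \<Longrightarrow> (\<And>p. p \<in> V \<Longrightarrow> c \<le> cos (angle_of V p)) \<Longrightarrow> c \<le> c_T V"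
  using is_triangle_finite[of V] by (auto simp: c_T_def)

lemma delta_T_ge: "finite V \<Longrightarrow> p \<in> V \<Longrightarrow> q \<in> V \<Longrightarrow> \<bar>\<phi> p - \<phi> q\<bar> \<le> delta_T V \<phi>"
  unfolding delta_T_def by (rule Max_ge) auto

section \<open>Positivity on a mixed triangle, in terms of nodal differences\<close>

lemma norm_le_delta:
  assumes tri: "is_triangle {p, q, r}" and "\<bar>w \<bullet> (q - p)\<bar> \<le> \<delta>" "\<bar>w \<bullet> (r - p)\<bar> \<le> \<delta>"
  shows "norm w \<le> \<delta> * (norm (hat_grad q r p) + norm (hat_grad r p q))"
proof -
  have "norm w = norm ((w \<bullet> (q - p)) *\<^sub>R hat_grad q r p + (w \<bullet> (r - p)) *\<^sub>R hat_grad r p q)"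
    using hat_grad_decomposition[OF is_triangleD(4)[OF tri], of w] by simp
  also have "\<dots> \<le> \<bar>w \<bullet> (q - p)\<bar> * norm (hat_grad q r p) + \<bar>w \<bullet> (r - p)\<bar> * norm (hat_grad r p q)"
    by (rule norm_triangle_le) simp
  also have "\<dots> \<le> \<delta> * norm (hat_grad q r p) + \<delta> * norm (hat_grad r p q)"
    using assms by (intro add_mono mult_right_mono) auto
  finally show ?thesis
    by (simp add: distrib_left)
qed

text \<open>Here \<open>p\<close> is the odd node, with \<open>\<sigma> = 1\<close> if the test
  function is \<open>1\<close> there and \<open>\<sigma> = -1\<close> if it is \<open>0\<close>;
  \<open>dq\<close> and \<open>dr\<close> are the nodal jumps of the difference of the two
  functions, and \<open>e\<close> is the value of that difference at the point considered. All three
  contributions are measured in the unit \<open>hp * S\<close>, and \<open>cond\<close> says that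
  the diffusion coefficient exceeds the other two.\<close>

lemma mixed_triangle_integrand_pos:
  fixes F F' :: "real \<Rightarrow> real"
  assumes V: "V = {p, q, r}" and tri: "is_triangle V"
    and acute: "\<And>v. v \<in> V \<Longrightarrow> cos (angle_of V v) \<ge> 0"
    and F: "\<And>s. s \<ge> 0 \<Longrightarrow> (F has_real_derivative F' s) (at s within {0..})"
    and F_ge: "\<And>s. s \<ge> 0 \<Longrightarrow> F s \<ge> l" and F'_le: "\<And>s. s \<ge> 0 \<Longrightarrow> s * \<bar>F' s\<bar> \<le> C" and l: "l \<ge> 0"
    and \<sigma>: "\<sigma> = 1 \<or> \<sigma> = -1"
    and dq_eq: "dq = \<sigma> * ((\<xi>\<^sub>1 - \<xi>\<^sub>2) \<bullet> (p - q))" and dq: "dq > 0"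
    and dr_eq: "dr = \<sigma> * ((\<xi>\<^sub>1 - \<xi>\<^sub>2) \<bullet> (p - r))" and dr: "dr > 0"
    and e: "\<bar>e\<bar> \<le> max dq dr"
    and \<delta>: "\<bar>\<xi>\<^sub>2 \<bullet> (q - p)\<bar> \<le> \<delta>" "\<bar>\<xi>\<^sub>2 \<bullet> (r - p)\<bar> \<le> \<delta>"
    and FA: "\<bar>F (norm \<xi>\<^sub>2) - A\<^sub>2\<bar> \<le> K * \<bar>e\<bar>" and K: "K \<ge> 0"
    and b: "\<bar>b\<^sub>1 - b\<^sub>2\<bar> \<le> B * \<bar>e\<bar>" and B: "B \<ge> 0"
    and v: "0 \<le> v" "v \<le> 1"
    and cond: "l * c_T V - C - \<delta> * (7 * K * (1 + 1 / r_T V) / 6) - 7 * B * area_T V * s_T V / 3 > 0"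
  shows "(F (norm \<xi>\<^sub>1) *\<^sub>R \<xi>\<^sub>1 - A\<^sub>2 *\<^sub>R \<xi>\<^sub>2) \<bullet> (\<sigma> *\<^sub>R hat_grad p q r) + (b\<^sub>1 - b\<^sub>2) * v > 0"
proof -
  define z where "z = \<sigma> *\<^sub>R hat_grad p q r"
  define hp where "hp = norm (hat_grad p q r)"
  define hq where "hq = norm (hat_grad q r p)"
  define hr where "hr = norm (hat_grad r p q)"
  define S where "S = dq * hq + dr * hr"
  have tri_q: "is_triangle {q, r, p}" and tri_r: "is_triangle {r, p, q}" and tri_s: "is_triangle {p, r, q}"
    and tri_r': "is_triangle {r, q, p}"
    using tri by (simp_all add: V insert_commute)
  have tri_p: "is_triangle {p, q, r}"
    using tri by (simp add: V)
  have [simp]: "p \<in> V" "q \<in> V" "r \<in> V"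
    unfolding V by auto
  have [simp]: "{p, q, r} = V" "{q, r, p} = V" "{r, p, q} = V" "{p, r, q} = V" "{q, p, r} = V" "{r, q, p} = V"
    unfolding V by auto
  have h: "hp > 0" "hq > 0" "hr > 0"
    unfolding hp_def hq_def hr_def using norm_hat_grad_pos tri_p tri_q tri_r by blast+
  have \<sigma>': "\<bar>\<sigma>\<bar> = 1" "\<sigma> * \<sigma> = 1"
    using \<sigma> by auto
  have nz: "norm z = hp"
    by (simp add: z_def hp_def \<sigma>')
  have rpos: "r_T V > 0"
    using r_T_pos[OF tri] .
  have S: "S > 0"
    unfolding S_def using dq dr h by (intro add_pos_pos mult_pos_pos)
  have s: "s_T V \<ge> 0"
    using s_T_ge[OF tri, of p] sin_angle_of_pos[OF tri, of p] by simp
  have \<delta>0: "\<delta> \<ge> 0"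
    using \<delta>(1) by linarith
  have area: "area_T V \<ge> 0"
    using area_T_triangle[of p q r] by simp

  have 1: "z \<bullet> (F (norm \<xi>\<^sub>1) *\<^sub>R \<xi>\<^sub>1 - F (norm \<xi>\<^sub>2) *\<^sub>R \<xi>\<^sub>2) \<ge> (l * c_T V - C) * hp * S"
  proof -
    \<comment> \<open>With these signs the coefficients of the gradient difference are the positive
      jumps \<open>dq\<close> and \<open>dr\<close>, and both directions form an acute or right
      angle with \<open>z\<close>.\<close>
    let ?\<zeta>q = "- (\<sigma> *\<^sub>R hat_grad q r p)" and ?\<zeta>r = "- (\<sigma> *\<^sub>R hat_grad r p q)"
    have "\<xi>\<^sub>1 - \<xi>\<^sub>2 = ((\<xi>\<^sub>1 - \<xi>\<^sub>2) \<bullet> (q - p)) *\<^sub>R hat_grad q r p + ((\<xi>\<^sub>1 - \<xi>\<^sub>2) \<bullet> (r - p)) *\<^sub>R hat_grad r p q"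
      by (rule hat_grad_decomposition) (rule is_triangleD(4)[OF tri_p])
    also have "\<dots> = ((\<sigma> * \<sigma>) * ((\<xi>\<^sub>1 - \<xi>\<^sub>2) \<bullet> (q - p))) *\<^sub>R hat_grad q r p
        + ((\<sigma> * \<sigma>) * ((\<xi>\<^sub>1 - \<xi>\<^sub>2) \<bullet> (r - p))) *\<^sub>R hat_grad r p q"
      by (simp add: \<sigma>')
    also have "\<dots> = dq *\<^sub>R ?\<zeta>q + dr *\<^sub>R ?\<zeta>r"
      by (simp add: dq_eq dr_eq inner_diff_right algebra_simps)
    finally have diff: "\<xi>\<^sub>1 - \<xi>\<^sub>2 = dq *\<^sub>R ?\<zeta>q + dr *\<^sub>R ?\<zeta>r" .
    have "z \<bullet> ?\<zeta>q = cos (angle_of V r) * (hp * hq)"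
      using hat_grad_inner_eq_cos[OF tri_p] by (simp add: z_def \<sigma>' hp_def hq_def flip: mult.assoc)
    then have a1: "z \<bullet> ?\<zeta>q \<ge> c_T V * (norm z * norm ?\<zeta>q)"
      using c_T_le[OF tri, of r] h by (simp add: nz \<sigma>' hq_def mult_right_mono)
    have "z \<bullet> ?\<zeta>r = cos (angle_of V q) * (hp * hr)"
      using hat_grad_inner_eq_cos[OF tri_s]
      by (simp add: z_def \<sigma>' hp_def hr_def hat_grad_swap[of p r q] hat_grad_swap[of r q p] flip: mult.assoc)
    then have a2: "z \<bullet> ?\<zeta>r \<ge> c_T V * (norm z * norm ?\<zeta>r)"
      using c_T_le[OF tri, of q] h by (simp add: nz \<sigma>' hr_def mult_right_mono)
    have "c_T V \<ge> 0"
      using acute by (intro c_T_ge[OF tri]) auto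
    from radial_flux_diff_ge[OF F F_ge F'_le diff _ _ a1 a2 this l] show ?thesis
      using dq dr by (simp add: nz S_def hq_def hr_def \<sigma>')
  qed

  \<comment> \<open>The larger jump is already weighted by its own gradient norm in
    \<open>S\<close>; the other gradient norm exceeds that one by at most the factor
    \<open>1 / r_T V\<close>.\<close>
  have max_le: "(hq + hr) * max dq dr \<le> (1 + 1 / r_T V) * S"
  proof (cases "dq \<ge> dr")
    case True
    have "hr \<le> hq / r_T V"
      using norm_hat_grad_le_r_T[OF tri_q] by (simp add: hq_def hr_def)
    then have "(hq + hr) * dq \<le> (hq + hq / r_T V) * dq"
      using dq by (intro mult_right_mono) auto
    also have "\<dots> = (1 + 1 / r_T V) * (dq * hq)"
      by (simp add: algebra_simps)
    also have "\<dots> \<le> (1 + 1 / r_T V) * S"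
      using rpos dr h unfolding S_def by (intro mult_left_mono) auto
    finally show ?thesis
      using True by (simp add: max_def)
  next
    case False
    have "hq \<le> hr / r_T V"
      using norm_hat_grad_le_r_T[OF tri_r'] by (simp add: hq_def hr_def hat_grad_swap[of r q p] hat_grad_swap[of q p r])
    then have "(hq + hr) * dr \<le> (hr + hr / r_T V) * dr"
      using dr by (intro mult_right_mono) auto
    also have "\<dots> = (1 + 1 / r_T V) * (dr * hr)"
      by (simp add: algebra_simps)
    also have "\<dots> \<le> (1 + 1 / r_T V) * S"
      using rpos dq h unfolding S_def by (intro mult_left_mono) auto
    finally show ?thesis
      using False by (simp add: max_def)
  qed

  \<comment> \<open>The cost of replacing the coefficient: its change is at most
    \<open>K * max dq dr\<close>, and it multiplies a gradient of norm at most
    \<open>\<delta> * (hq + hr)\<close>.\<close>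
  have 2: "\<bar>(F (norm \<xi>\<^sub>2) - A\<^sub>2) * (z \<bullet> \<xi>\<^sub>2)\<bar> \<le> \<delta> * (K * (1 + 1 / r_T V)) * hp * S"
  proof -
    have "\<bar>(F (norm \<xi>\<^sub>2) - A\<^sub>2) * (z \<bullet> \<xi>\<^sub>2)\<bar> \<le> (K * max dq dr) * (hp * (\<delta> * (hq + hr)))"
      unfolding abs_mult
    proof (intro mult_mono)
      show "\<bar>F (norm \<xi>\<^sub>2) - A\<^sub>2\<bar> \<le> K * max dq dr"
        using FA mult_left_mono[OF e K] by linarith
      have "\<bar>z \<bullet> \<xi>\<^sub>2\<bar> \<le> hp * norm \<xi>\<^sub>2"
        using Cauchy_Schwarz_ineq2[of z \<xi>\<^sub>2] by (simp add: nz)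
      also have "\<dots> \<le> hp * (\<delta> * (hq + hr))"
        using norm_le_delta[OF tri_p \<delta>] h by (simp add: hq_def hr_def)
      finally show "\<bar>z \<bullet> \<xi>\<^sub>2\<bar> \<le> hp * (\<delta> * (hq + hr))" .
    qed (use K dq in auto)
    also have "\<dots> = (\<delta> * K * hp) * ((hq + hr) * max dq dr)"
      by (simp add: mult_ac)
    also have "\<dots> \<le> (\<delta> * K * hp) * ((1 + 1 / r_T V) * S)"
      using \<delta>0 K h by (intro mult_left_mono max_le) auto
    finally show ?thesis
      by (simp add: mult_ac)
  qed

  \<comment> \<open>The jump is multiplied by the scaling identity, a factor equal to
    \<open>1\<close>, and the sine is then enlarged to \<open>s_T V\<close>.\<close>
  have d_le: "d \<le> 2 * area_T V * s_T V * hp * S"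
    if "hp * h' * (2 * area_T V) * sin (angle_of V w) = 1" "w \<in> V" "h' \<ge> 0" "d \<ge> 0" "d * h' \<le> S" for d h' w
  proof -
    have "d = d * (hp * h' * (2 * area_T V) * sin (angle_of V w))"
      using that by simp
    also have "\<dots> \<le> d * (hp * h' * (2 * area_T V) * s_T V)"
      using that h area s_T_ge[OF tri that(2)] by (intro mult_left_mono mult_nonneg_nonneg) auto
    also have "\<dots> = (2 * area_T V * s_T V * hp) * (d * h')"
      by (simp add: mult_ac)
    also have "\<dots> \<le> (2 * area_T V * s_T V * hp) * S"
      using that h area s by (intro mult_left_mono mult_nonneg_nonneg) auto
    finally show ?thesis .
  qed
  have "dq \<le> 2 * area_T V * s_T V * hp * S"
    using norm_hat_grad_times_sin[OF tri_p] dq dr h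
    by (intro d_le[of hq r]) (auto simp: hp_def hq_def S_def)
  moreover have "dr \<le> 2 * area_T V * s_T V * hp * S"
    using norm_hat_grad_times_sin[OF tri_s] dq dr h
    by (intro d_le[of hr q]) (auto simp: hp_def hr_def S_def hat_grad_swap[of p r q] hat_grad_swap[of r q p])
  ultimately have e': "\<bar>e\<bar> \<le> 2 * area_T V * s_T V * hp * S"
    using e by linarith
  have 3: "\<bar>(b\<^sub>1 - b\<^sub>2) * v\<bar> \<le> B * (2 * area_T V * s_T V) * hp * S"
  proof -
    have "\<bar>(b\<^sub>1 - b\<^sub>2) * v\<bar> \<le> \<bar>b\<^sub>1 - b\<^sub>2\<bar>"
      unfolding abs_mult using v by (intro mult_left_le) auto
    also have "\<dots> \<le> B * (2 * area_T V * s_T V * hp * S)"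
      using b mult_left_mono[OF e' B] by linarith
    finally show ?thesis
      by (simp add: mult_ac)
  qed

  \<comment> \<open>The bounds above carry the factors \<open>1\<close> and \<open>2\<close>, below
    the \<open>7/6\<close> and \<open>7/3\<close> of \<open>cond\<close>.\<close>
  have "\<delta> * (K * (1 + 1 / r_T V)) \<le> \<delta> * (7 * K * (1 + 1 / r_T V) / 6)"
  proof (rule mult_left_mono[OF _ \<delta>0])
    have "x * y \<le> 7 * x * y / 6" if "x * y \<ge> 0" for x y :: real
      using that by simp
    then show "K * (1 + 1 / r_T V) \<le> 7 * K * (1 + 1 / r_T V) / 6"
      using K rpos by simp
  qed
  moreover have "B * area_T V * s_T V \<ge> 0"
    using B area s by simp
  then have "B * (2 * area_T V * s_T V) \<le> 7 * B * area_T V * s_T V / 3"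
    by linarith
  ultimately have "l * c_T V - C - \<delta> * (K * (1 + 1 / r_T V)) - B * (2 * area_T V * s_T V) > 0"
    using cond by linarith
  then have "(l * c_T V - C - \<delta> * (K * (1 + 1 / r_T V)) - B * (2 * area_T V * s_T V)) * (hp * S) > 0"
    using S h by (intro mult_pos_pos)
  then have "(l * c_T V - C) * hp * S - \<delta> * (K * (1 + 1 / r_T V)) * hp * S - B * (2 * area_T V * s_T V) * hp * S > 0"
    by (simp only: left_diff_distrib mult.assoc)
  \<comment> \<open>Adding and subtracting
    \<open>F (norm \<xi>\<^sub>2) *\<^sub>R \<xi>\<^sub>2\<close> separates the change of gradient
    from the change of coefficient.\<close>
  moreover have "(F (norm \<xi>\<^sub>1) *\<^sub>R \<xi>\<^sub>1 - A\<^sub>2 *\<^sub>R \<xi>\<^sub>2) \<bullet> z =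
      z \<bullet> (F (norm \<xi>\<^sub>1) *\<^sub>R \<xi>\<^sub>1 - F (norm \<xi>\<^sub>2) *\<^sub>R \<xi>\<^sub>2) + (F (norm \<xi>\<^sub>2) - A\<^sub>2) * (z \<bullet> \<xi>\<^sub>2)"
    by (simp add: inner_diff_left inner_diff_right inner_commute left_diff_distrib)
  ultimately show ?thesis
    using 1 2 3 unfolding z_def by linarith
qed

section \<open>Affine functions on triangles and nodal interpolation\<close>

lemma affine_ge_on_hull:
  assumes "\<And>y. y \<in> V \<Longrightarrow> w \<bullet> y + c \<ge> (m::real)" "x \<in> convex hull V"
  shows "w \<bullet> x + c \<ge> m"
proof -
  have "convex hull V \<subseteq> {x. w \<bullet> x \<ge> m - c}"
    using assms(1) by (intro hull_minimal convex_halfspace_ge) (force simp: algebra_simps)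
  then show ?thesis
    using assms(2) by (auto simp: algebra_simps)
qed

lemma affine_eq_on_hull:
  fixes w w' :: "'a::real_inner"
  assumes "\<And>y. y \<in> V \<Longrightarrow> w \<bullet> y + c = w' \<bullet> y + (c'::real)" "x \<in> convex hull V"
  shows "w \<bullet> x + c = w' \<bullet> x + c'"
proof -
  have "w \<bullet> y - w' \<bullet> y + (c - c') = 0" if "y \<in> V" for y
    using assms(1)[OF that] by simp
  then have "0 \<le> (w - w') \<bullet> x + (c - c')" "0 \<le> (w' - w) \<bullet> x + (c' - c)"
    by (intro affine_ge_on_hull[OF _ assms(2)]; simp add: inner_diff_left algebra_simps)+
  then show ?thesis
    by (simp add: inner_diff_left)
qed

lemma affine_on_triangle_exists:
  fixes val :: "pt \<Rightarrow> real"
  assumes "is_triangle V"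
  shows "\<exists>w c. \<forall>y\<in>V. w \<bullet> y + c = val y"
proof -
  obtain p where "p \<in> V"
    using is_triangle_finite[OF assms] by auto
  then obtain q r where V: "V = {p, q, r}"
    using is_triangleE assms by metis
  have D: "tri_det q r p \<noteq> 0" "tri_det r p q \<noteq> 0"
    using is_triangleD(4) assms unfolding V
    by (simp_all add: tri_det_rotate[of q r p] tri_det_rotate[of r p q])
  define w where "w = (val q - val p) *\<^sub>R hat_grad q r p + (val r - val p) *\<^sub>R hat_grad r p q"
  have "w \<bullet> (q - p) = val q - val p" "w \<bullet> (r - p) = val r - val p"
  proof -
    have "hat_grad r p q \<bullet> (q - p) = 0"
      using hat_grad_inner_vertex(3)[OF D(2)] by (simp add: inner_diff_right)
    then show "w \<bullet> (q - p) = val q - val p" "w \<bullet> (r - p) = val r - val p"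
      using hat_grad_inner_vertex[OF D(1)] hat_grad_inner_vertex[OF D(2)]
      by (simp_all add: w_def inner_add_left)
  qed
  then have "\<forall>y\<in>V. w \<bullet> y + (val p - w \<bullet> p) = val y"
    unfolding V by (auto simp: inner_diff_right)
  then show ?thesis
    by blast
qed

text \<open>The affine pieces fit together because, by conformity, two triangles meet in the hull of
  their shared vertices, where both pieces take the prescribed nodal values. Continuity follows by
  gluing over finitely many closed triangles.\<close>

lemma conforming_interpolant:
  fixes val :: "pt \<Rightarrow> real"
  assumes "conforming \<T>"
  obtains v where "\<forall>V\<in>\<T>. \<exists>w c. \<forall>x\<in>convex hull V. v x = w \<bullet> x + c"
    and "\<And>V y. V \<in> \<T> \<Longrightarrow> y \<in> V \<Longrightarrow> v y = val y"
    and "continuous_on (\<Union>V\<in>\<T>. convex hull V) v"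
proof -
  have T: "finite \<T>" "\<And>V. V \<in> \<T> \<Longrightarrow> is_triangle V"
    and inter: "\<And>V W. V \<in> \<T> \<Longrightarrow> W \<in> \<T> \<Longrightarrow> V \<noteq> W \<Longrightarrow> convex hull V \<inter> convex hull W = convex hull (V \<inter> W)"
    using assms by (auto simp: conforming_def)
  have "\<forall>V\<in>\<T>. \<exists>w c. \<forall>y\<in>V. w \<bullet> y + c = val y"
    using affine_on_triangle_exists T(2) by blast
  then obtain w c where wc: "\<And>V y. V \<in> \<T> \<Longrightarrow> y \<in> V \<Longrightarrow> w V \<bullet> y + c V = val y"
    by metis
  define v where "v x = (let V = SOME V. V \<in> \<T> \<and> x \<in> convex hull V in w V \<bullet> x + c V)" for x
  have v: "v x = w V \<bullet> x + c V" if V: "V \<in> \<T>" "x \<in> convex hull V" for V x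
  proof -
    define W where "W = (SOME V. V \<in> \<T> \<and> x \<in> convex hull V)"
    have W: "W \<in> \<T>" "x \<in> convex hull W"
      using someI[of "\<lambda>V. V \<in> \<T> \<and> x \<in> convex hull V" V] V unfolding W_def by auto
    have "x \<in> convex hull (W \<inter> V)"
      using inter[OF W(1) V(1)] W V by (cases "W = V") auto
    then have "w W \<bullet> x + c W = w V \<bullet> x + c V"
      by (rule affine_eq_on_hull[rotated]) (use wc W V in auto)
    then show ?thesis
      by (simp add: v_def Let_def W_def)
  qed
  show ?thesis
  proof
    show "\<forall>V\<in>\<T>. \<exists>w c. \<forall>x\<in>convex hull V. v x = w \<bullet> x + c"
      using v by blast
    show "v y = val y" if "V \<in> \<T>" "y \<in> V" for V y
      using v[OF that(1) hull_inc[OF that(2)]] wc[OF that] by simp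
    show "continuous_on (\<Union>V\<in>\<T>. convex hull V) v"
    proof (rule continuous_on_closed_Union)
      show "closed (convex hull V)" if "V \<in> \<T>" for V
        using is_triangle_finite T(2)[OF that]
        by (intro compact_imp_closed compact_convex_hull finite_imp_compact) auto
      show "continuous_on (convex hull V) v" if "V \<in> \<T>" for V
        using v[OF that] by (subst continuous_on_cong[OF refl]) (auto intro!: continuous_intros)
    qed (rule T(1))
  qed
qed

text \<open>Uniqueness of the derivative at a point fixes the vector chosen in
  \<open>grad\<close>.\<close>

lemma grad_affine:
  assumes "x \<in> interior S" "\<And>y. y \<in> S \<Longrightarrow> u y = w \<bullet> y + c"
  shows "grad u x = w"
proof -
  have "((\<lambda>y. w \<bullet> y + c) has_derivative (\<lambda>h. w \<bullet> h)) (at x)"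
    by (auto intro!: derivative_eq_intros)
  then have u: "(u has_derivative (\<lambda>h. w \<bullet> h)) (at x)"
    by (rule has_derivative_transform_within_open[OF _ open_interior assms(1)])
      (use assms(2) interior_subset in fastforce)
  show ?thesis
    unfolding grad_def
  proof (rule some_equality)
    show "(u has_derivative (\<lambda>h. w \<bullet> h)) (at x)"
      by (rule u)
    show "w' = w" if "(u has_derivative (\<lambda>h. w' \<bullet> h)) (at x)" for w'
      using has_derivative_unique[OF that u] by (auto simp: fun_eq_iff vector_eq_rdot)
  qed
qed

section \<open>The domain as a union of triangles\<close>

lemma is_triangle_interior_hull:
  assumes "is_triangle V"
  shows "interior (convex hull V) \<noteq> {}"
proof -
  obtain p where "p \<in> V"
    using is_triangle_finite[OF assms] by auto
  then obtain q r where V: "V = {p, q, r}"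
    using is_triangleE assms by metis
  show ?thesis
    using assms unfolding is_triangle_def
    by (subst interior_convex_hull_eq_empty) (auto simp: V collinear_3_eq_affine_dependent)
qed

text \<open>Each triangle is the closure of its interior, and these interiors lie in
  \<open>\<Omega>\<close>; so no part of a triangle is lost when passing to the interior of the
  union.\<close>

lemma triangulates_closure:
  assumes "triangulates \<T> \<Omega>"
  shows "closure \<Omega> = (\<Union>V\<in>\<T>. convex hull V)" (is "_ = ?K")
proof
  have T: "finite \<T>" "\<And>V. V \<in> \<T> \<Longrightarrow> is_triangle V" and \<Omega>: "\<Omega> = interior ?K"
    using assms by (auto simp: triangulates_def conforming_def)
  have cl: "closed (convex hull V)" if "V \<in> \<T>" for V
    using is_triangle_finite T(2)[OF that]
    by (intro compact_imp_closed compact_convex_hull finite_imp_compact) auto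
  have "closed ?K"
    using T(1) cl by auto
  then show "closure \<Omega> \<subseteq> ?K"
    unfolding \<Omega> by (intro closure_minimal interior_subset)
  show "?K \<subseteq> closure \<Omega>"
  proof (rule UN_least)
    fix V assume V: "V \<in> \<T>"
    have "convex hull V = closure (interior (convex hull V))"
      using convex_closure_interior[OF convex_convex_hull is_triangle_interior_hull[OF T(2)[OF V]]] cl[OF V]
      by simp
    also have "\<dots> \<subseteq> closure \<Omega>"
      unfolding \<Omega> using V by (intro closure_mono interior_mono) auto
    finally show "convex hull V \<subseteq> closure \<Omega>" .
  qed
qed

text \<open>Boundaries of convex sets are negligible. Almost every point thus lies where all
  gradients are those of affine functions.\<close>

lemma triangulates_AE_interior:
  assumes "triangulates \<T> \<Omega>"
  shows "AE x in lebesgue. x \<in> \<Omega> \<longrightarrow> (\<exists>V\<in>\<T>. x \<in> interior (convex hull V))"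
proof (rule AE_I')
  have "negligible (\<Union>((\<lambda>V. frontier (convex hull V)) ` \<T>))"
    using assms unfolding triangulates_def conforming_def
    by (intro negligible_Union) (auto intro: negligible_convex_frontier)
  then show "\<Union>((\<lambda>V. frontier (convex hull V)) ` \<T>) \<in> null_sets lebesgue"
    by (simp add: negligible_iff_null_sets)
  have "\<Omega> \<subseteq> (\<Union>V\<in>\<T>. convex hull V)"
    using triangulates_closure[OF assms] closure_subset by blast
  moreover have "convex hull V - interior (convex hull V) \<subseteq> frontier (convex hull V)" for V :: "pt set"
    unfolding frontier_def using closure_subset by (rule Diff_mono) simp
  ultimately show "{x \<in> space lebesgue. \<not> (x \<in> \<Omega> \<longrightarrow> (\<exists>V\<in>\<T>. x \<in> interior (convex hull V)))}
      \<subseteq> \<Union>((\<lambda>V. frontier (convex hull V)) ` \<T>)"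
    by blast
qed

lemma real_lipschitz_of_bounded_deriv:
  fixes h h' :: "real \<Rightarrow> real"
  assumes "\<And>t. (h has_real_derivative h' t) (at t)" "\<And>t. \<bar>h' t\<bar> \<le> L"
  shows "\<bar>h s - h t\<bar> \<le> L * \<bar>s - t\<bar>"
  using field_differentiable_bound[of UNIV h h' L s t] assms by auto

section \<open>Positivity on a mixed triangle, for the nodal test function\<close>

lemma mixed_triangle_interpolant_integrand_pos:
  fixes F F' :: "real \<Rightarrow> real"
  assumes tri: "is_triangle V"
    and acute: "\<And>v. v \<in> V \<Longrightarrow> cos (angle_of V v) \<ge> 0"
    and F: "\<And>s. s \<ge> 0 \<Longrightarrow> (F has_real_derivative F' s) (at s within {0..})"
    and F_ge: "\<And>s. s \<ge> 0 \<Longrightarrow> F s \<ge> l" and F'_le: "\<And>s. s \<ge> 0 \<Longrightarrow> s * \<bar>F' s\<bar> \<le> C" and l: "l \<ge> 0"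
    and u\<^sub>1: "\<And>y. y \<in> convex hull V \<Longrightarrow> u\<^sub>1 y = \<xi>\<^sub>1 \<bullet> y + c\<^sub>1"
    and u\<^sub>2: "\<And>y. y \<in> convex hull V \<Longrightarrow> u\<^sub>2 y = \<xi>\<^sub>2 \<bullet> y + c\<^sub>2"
    and v: "\<And>y. y \<in> convex hull V \<Longrightarrow> v y = \<zeta> \<bullet> y + c"
    and val: "\<And>y. y \<in> V \<Longrightarrow> v y = (if u\<^sub>1 y > u\<^sub>2 y then 1 else 0)"
    and mixed: "\<exists>y\<in>V. u\<^sub>1 y > u\<^sub>2 y" "\<exists>y\<in>V. \<not> u\<^sub>1 y > u\<^sub>2 y"
    and x: "x \<in> convex hull V"
    and FA: "\<bar>F (norm \<xi>\<^sub>2) - A\<^sub>2\<bar> \<le> K * \<bar>u\<^sub>1 x - u\<^sub>2 x\<bar>" and K: "K \<ge> 0"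
    and b: "\<bar>b\<^sub>1 - b\<^sub>2\<bar> \<le> B * \<bar>u\<^sub>1 x - u\<^sub>2 x\<bar>" and B: "B \<ge> 0"
    and cond: "l * c_T V - C - delta_T V u\<^sub>2 * (7 * K * (1 + 1 / r_T V) / 6)
      - 7 * B * area_T V * s_T V / 3 > 0"
  shows "(F (norm \<xi>\<^sub>1) *\<^sub>R \<xi>\<^sub>1 - A\<^sub>2 *\<^sub>R \<xi>\<^sub>2) \<bullet> \<zeta> + (b\<^sub>1 - b\<^sub>2) * v x > 0"
proof -
  define w where "w y = u\<^sub>1 y - u\<^sub>2 y" for y
  have w: "w y = (\<xi>\<^sub>1 - \<xi>\<^sub>2) \<bullet> y + (c\<^sub>1 - c\<^sub>2)" if "y \<in> convex hull V" for y
    using u\<^sub>1[OF that] u\<^sub>2[OF that] by (simp add: w_def inner_diff_left)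
  \<comment> \<open>Of three nodes in two nonempty classes, exactly one is alone in its class; it
    becomes \<open>p\<close>.\<close>
  have "\<exists>p q r (\<sigma>::real). V = {p, q, r} \<and> (\<sigma> = 1 \<and> w p > 0 \<and> w q \<le> 0 \<and> w r \<le> 0 \<or>
      \<sigma> = -1 \<and> w p \<le> 0 \<and> w q > 0 \<and> w r > 0)"
  proof -
    obtain y z where yz: "y \<in> V" "w y > 0" "z \<in> V" "w z \<le> 0"
      using mixed by (auto simp: w_def not_less)
    obtain q r where V: "V = {y, q, r}"
      using is_triangleE[OF tri yz(1)] .
    have perm: "V = {q, r, y}" "V = {r, q, y}"
      using V by auto
    consider "w q \<le> 0" "w r \<le> 0" | "w q > 0" "w r \<le> 0" | "w q \<le> 0" "w r > 0"
      using yz V by force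
    then show ?thesis
      by cases (use V perm yz(2) in blast)+
  qed
  then obtain p q r \<sigma> where V: "V = {p, q, r}" and \<sigma>: "\<sigma> = (1::real) \<and> w p > 0 \<and> w q \<le> 0 \<and> w r \<le> 0 \<or>
      \<sigma> = -1 \<and> w p \<le> 0 \<and> w q > 0 \<and> w r > 0"
    by blast
  have in_V: "p \<in> V" "q \<in> V" "r \<in> V"
    using V by auto
  then have hull: "p \<in> convex hull V" "q \<in> convex hull V" "r \<in> convex hull V"
    by (simp_all add: hull_inc)
  have diffs: "(\<xi>\<^sub>1 - \<xi>\<^sub>2) \<bullet> (p - q) = w p - w q" "(\<xi>\<^sub>1 - \<xi>\<^sub>2) \<bullet> (p - r) = w p - w r"
    "\<xi>\<^sub>2 \<bullet> (q - p) = u\<^sub>2 q - u\<^sub>2 p" "\<xi>\<^sub>2 \<bullet> (r - p) = u\<^sub>2 r - u\<^sub>2 p"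
    "\<zeta> \<bullet> (q - p) = v q - v p" "\<zeta> \<bullet> (r - p) = v r - v p"
    using hull by (simp_all add: w u\<^sub>2 v inner_diff_right)
  have vals: "v q - v p = - \<sigma>" "v r - v p = - \<sigma>"
    using \<sigma> val[OF in_V(1)] val[OF in_V(2)] val[OF in_V(3)] by (auto simp: w_def)
  have D: "tri_det p q r \<noteq> 0"
    using is_triangleD(4) tri by (simp add: V)
  have "\<zeta> = - \<sigma> *\<^sub>R hat_grad q r p + - \<sigma> *\<^sub>R hat_grad r p q"
    using hat_grad_decomposition[OF D, of \<zeta>] by (simp only: diffs vals)
  also have "\<dots> = \<sigma> *\<^sub>R hat_grad p q r"
    using hat_grad_sum[OF D] by (metis scaleR_add_right scaleR_minus_left scaleR_minus_right minus_minus)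
  finally have \<zeta>: "\<zeta> = \<sigma> *\<^sub>R hat_grad p q r" .
  \<comment> \<open>The differences at \<open>p\<close> and at the other nodes have opposite signs,
    so each jump is the sum of two absolute values and bounds \<open>w\<close> at both ends;
    affinity carries the bound to \<open>x\<close>.\<close>
  let ?m = "max (\<sigma> * (w p - w q)) (\<sigma> * (w p - w r))"
  have "\<bar>w y\<bar> \<le> ?m" if "y \<in> V" for y
    using that \<sigma> unfolding V by (auto simp: max_def)
  then have wm: "- ?m \<le> w y" "- ?m \<le> - w y" if "y \<in> V" for y
    using that by fastforce+
  have "- ?m \<le> (\<xi>\<^sub>1 - \<xi>\<^sub>2) \<bullet> x + (c\<^sub>1 - c\<^sub>2)"
    using wm(1) w by (intro affine_ge_on_hull[OF _ x]) (simp add: hull_inc)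
  moreover have "- ?m \<le> (- (\<xi>\<^sub>1 - \<xi>\<^sub>2)) \<bullet> x + (- (c\<^sub>1 - c\<^sub>2))"
    using wm(2) w by (intro affine_ge_on_hull[OF _ x]) (simp add: hull_inc inner_diff_left)
  ultimately have wx: "\<bar>w x\<bar> \<le> ?m"
    using w[OF x] by (simp add: inner_diff_left abs_le_iff)
  \<comment> \<open>The second inequality is the upper bound \<open>1\<close>, negated to fit
    \<open>affine_ge_on_hull\<close>.\<close>
  have vV: "0 \<le> \<zeta> \<bullet> y + c" "-1 \<le> - \<zeta> \<bullet> y + - c" if "y \<in> V" for y
    using v[OF hull_inc[OF that]] val[OF that] by (auto split: if_splits)
  have v0: "0 \<le> v x" and v1: "v x \<le> 1"
    using affine_ge_on_hull[OF vV(1) x] affine_ge_on_hull[OF vV(2) x] v[OF x] by simp_all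
  have \<sigma>': "\<sigma> = 1 \<or> \<sigma> = -1"
    and d: "\<sigma> * (w p - w q) > 0" "\<sigma> * (w p - w r) > 0"
    using \<sigma> by auto
  have d_eq: "\<sigma> * (w p - w q) = \<sigma> * ((\<xi>\<^sub>1 - \<xi>\<^sub>2) \<bullet> (p - q))"
    "\<sigma> * (w p - w r) = \<sigma> * ((\<xi>\<^sub>1 - \<xi>\<^sub>2) \<bullet> (p - r))"
    by (simp_all only: diffs)
  have \<delta>: "\<bar>\<xi>\<^sub>2 \<bullet> (q - p)\<bar> \<le> delta_T V u\<^sub>2" "\<bar>\<xi>\<^sub>2 \<bullet> (r - p)\<bar> \<le> delta_T V u\<^sub>2"
    unfolding diffs using delta_T_ge is_triangle_finite(1)[OF tri] in_V by blast+
  show ?thesis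
    unfolding \<zeta>
    by (rule mixed_triangle_integrand_pos[OF V tri acute F F_ge F'_le l \<sigma>' d_eq(1) d(1) d_eq(2) d(2) wx
          \<delta> FA[folded w_def] K b[folded w_def] B v0 v1 cond])
qed

section \<open>The comparison principle\<close>

theorem theorem4p9:
  fixes \<Omega> :: "pt set" and \<T> :: "pt set set" and ED :: "pt set set"
    and A :: "pt \<Rightarrow> real \<Rightarrow> pt \<Rightarrow> real" and b :: "pt \<Rightarrow> real \<Rightarrow> real"
    and \<psi> :: "pt \<Rightarrow> real"
    and Da :: "pt \<Rightarrow> real \<Rightarrow> pt \<Rightarrow> pt \<Rightarrow> pt"
    and A_eta :: "pt \<Rightarrow> real \<Rightarrow> pt \<Rightarrow> real" and b_eta :: "pt \<Rightarrow> real \<Rightarrow> real"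
    and A0 A1 :: "pt \<Rightarrow> real \<Rightarrow> real" and A2 :: "pt \<Rightarrow> real"
    and f g f' g' :: "real \<Rightarrow> real"
    and t_min t_max gam_a K_eta B_eta lam0 Lam1 Lam2 Cf Cg :: real
    and u1 u2 :: "pt \<Rightarrow> real"
  defines "a \<equiv> (\<lambda>x \<eta> \<xi>. A x \<eta> \<xi> *\<^sub>R \<xi>)"
  assumes dom: "open \<Omega>" "bounded \<Omega>" "connected \<Omega>"
    and mesh: "triangulates \<T> \<Omega>"
    and dirichlet: "ED \<subseteq> boundary_edges \<T> \<Omega>" "ED \<noteq> {}"
    and psi_bdd: "\<exists>M. \<forall>x\<in>frontier \<Omega> - Gamma ED. \<bar>\<psi> x\<bar> \<le> M"
    and psi_meas: "\<forall>e\<in>boundary_edges \<T> \<Omega> - ED. \<forall>p q. e = {p, q} \<longrightarrow>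
                     (\<lambda>t. \<psi> (p + t *\<^sub>R (q - p))) \<in> borel_measurable (lebesgue_on {0..1})"
    and angles: "0 < t_min" "t_min \<le> t_max" "t_max < pi / 2"
      "\<forall>V\<in>\<T>. \<forall>p\<in>V. t_min \<le> angle_of V p \<and> angle_of V p \<le> t_max"
    \<comment> \<open>standing assumptions (S)\<close>
    and consts_S: "gam_a > 0" "K_eta > 0" "B_eta \<ge> 0"
    and a_meas: "\<forall>\<eta> \<xi>. (\<lambda>x. a x \<eta> \<xi>) \<in> borel_measurable (lebesgue_on \<Omega>)"
    and b_meas: "\<forall>\<eta>. (\<lambda>x. b x \<eta>) \<in> borel_measurable (lebesgue_on \<Omega>)"
    and S: "AE x in lebesgue. x \<in> \<Omega> \<longrightarrow>
       C1_fun (\<lambda>(\<eta>::real, \<xi>::pt). a x \<eta> \<xi>) \<and> C1_fun (b x) \<and>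
       (\<forall>\<eta> \<xi>. ((\<lambda>\<zeta>. a x \<eta> \<zeta>) has_derivative Da x \<eta> \<xi>) (at \<xi>) \<and>
               (\<forall>\<zeta>. gam_a * (norm \<zeta>)\<^sup>2 \<le> \<zeta> \<bullet> Da x \<eta> \<xi> \<zeta>) \<and>
               ((\<lambda>s. A x s \<xi>) has_real_derivative A_eta x \<eta> \<xi>) (at \<eta>) \<and>
               \<bar>A_eta x \<eta> \<xi>\<bar> \<le> K_eta \<and>
               (b x has_real_derivative b_eta x \<eta>) (at \<eta>) \<and>
               0 \<le> b_eta x \<eta> \<and> b_eta x \<eta> \<le> B_eta)"
    \<comment> \<open>structure (A)\<close>
    and consts_A: "lam0 > 0" "Lam1 \<ge> 0" "Lam2 \<ge> 0"
    and A_struct: "\<forall>x \<eta> \<xi>. A x \<eta> \<xi> = A0 x \<eta> + A1 x \<eta> * f (norm \<xi>) + A2 x * g (norm \<xi>)"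
    and A_bounds: "AE x in lebesgue. x \<in> \<Omega> \<longrightarrow>
       (\<forall>\<eta>. A0 x \<eta> \<ge> lam0 \<and> 0 \<le> A1 x \<eta> \<and> A1 x \<eta> \<le> Lam1) \<and> 0 \<le> A2 x \<and> A2 x \<le> Lam2"
    and fg: "\<forall>s\<ge>0. f s \<ge> 0 \<and> g s \<ge> 0 \<and>
       (f has_real_derivative f' s) (at s within {0..}) \<and> s * \<bar>f' s\<bar> \<le> Cf \<and>
       (g has_real_derivative g' s) (at s within {0..}) \<and> s * \<bar>g' s\<bar> \<le> Cg"
    \<comment> \<open>sub- and supersolution\<close>
    and sub: "discrete_subsolution \<T> \<Omega> ED a b \<psi> u1"
    and super: "discrete_supersolution \<T> \<Omega> ED a b \<psi> u2"
    \<comment> \<open>smallness conditions\<close>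
    and pos: "lam0 * cos t_max - Lam1 * Cf - Lam2 * Cg > 0"
    and cond: "Min ((\<lambda>V. min (lam0 * c_T V - Lam1 * Cf - Lam2 * Cg) (gam_a / r_T V)
                     - delta_T V u2 * (7 * K_eta * (1 + 1 / r_T V) / 6)
                     - 7 * B_eta * area_T V * s_T V / 3) ` \<T>) > 0"
  shows "\<forall>x\<in>\<Omega>. u1 x \<le> u2 x"
proof -
  let ?K = "\<Union>V\<in>\<T>. convex hull V"
  have conf: "conforming \<T>" and fin: "finite \<T>" and tri: "\<And>V. V \<in> \<T> \<Longrightarrow> is_triangle V"
    and \<Omega>: "\<Omega> = interior ?K"
    using mesh by (auto simp: triangulates_def conforming_def)
  have clo: "closure \<Omega> = ?K"
    by (rule triangulates_closure[OF mesh])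
  have hull_\<Omega>: "interior (convex hull V) \<subseteq> \<Omega>" if "V \<in> \<T>" for V
    unfolding \<Omega> using that by (intro interior_mono) auto
  have P1: "u1 \<in> P1_space \<T> \<Omega> (Gamma ED)" "u2 \<in> P1_space \<T> \<Omega> (Gamma ED)"
    using sub super by (auto simp: discrete_subsolution_def discrete_supersolution_def)

  obtain v where v_aff: "\<forall>V\<in>\<T>. \<exists>w c. \<forall>x\<in>convex hull V. v x = w \<bullet> x + c"
    and val: "\<And>V y. V \<in> \<T> \<Longrightarrow> y \<in> V \<Longrightarrow> v y = (if u1 y > u2 y then 1 else 0)"
    and v_cont: "continuous_on ?K v"
    using conforming_interpolant[OF conf, of "\<lambda>y. if u1 y > u2 y then 1 else 0"] by metis
  \<comment> \<open>A subset \<open>W\<close> of the vertices is allowed so that edges are covered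
    as well as triangles.\<close>
  have v_bounds: "m \<le> v x \<and> v x \<le> M"
    if V: "V \<in> \<T>" "W \<subseteq> V" and x: "x \<in> convex hull W" and W: "\<And>y. y \<in> W \<Longrightarrow> m \<le> v y \<and> v y \<le> M"
    for V W x m M
  proof -
    obtain w c where wc: "\<forall>x\<in>convex hull V. v x = w \<bullet> x + c"
      using v_aff V(1) by blast
    have "v y = w \<bullet> y + c" if "y \<in> W" for y
      using wc that V(2) by (meson hull_inc subsetD)
    then have "m \<le> w \<bullet> y + c" "- M \<le> - w \<bullet> y + - c" if "y \<in> W" for y
      using W that by fastforce+
    from affine_ge_on_hull[OF this(1) x] affine_ge_on_hull[OF this(2) x]
    show ?thesis
      using wc subsetD[OF hull_mono[OF V(2)] x] by simp
  qed
  have v_const: "v x = m" if "V \<in> \<T>" "W \<subseteq> V" "x \<in> convex hull W" "\<And>y. y \<in> W \<Longrightarrow> v y = m" for V W x m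
    using v_bounds[OF that(1-3), of m m] that(4) by fastforce

  \<comment> \<open>At the ends of a Dirichlet edge both functions vanish, so the strict inequality
    defining \<open>v\<close> fails there. This makes \<open>v\<close> admissible as a test
    function.\<close>
  have v0: "v x = 0" if edge: "e \<in> ED" and x: "x \<in> convex hull e" for e x
  proof -
    obtain V where V: "V \<in> \<T>" "e \<subseteq> V"
      using dirichlet(1) edge by (auto simp: boundary_edges_def)
    have "v y = 0" if "y \<in> e" for y
    proof -
      have "y \<in> Gamma ED"
        using hull_inc[OF that] edge by (auto simp: Gamma_def)
      then have "u1 y = 0" "u2 y = 0"
        using P1 by (auto simp: P1_space_def)
      then show ?thesis
        using val[OF V(1)] V(2) that by auto
    qed
    then show ?thesis
      using v_const[OF V(1) V(2) x] by blast
  qed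
  have "v \<in> P1_plus \<T> \<Omega> (Gamma ED)"
    unfolding P1_plus_def P1_space_def clo
  proof (intro CollectI conjI ballI)
    show "v x = 0" if "x \<in> Gamma ED" for x
      using that v0 by (auto simp: Gamma_def)
    show "0 \<le> v x" if "x \<in> ?K" for x
    proof -
      obtain V where "V \<in> \<T>" "x \<in> convex hull V"
        using \<open>x \<in> ?K\<close> by blast
      then show ?thesis
        using v_bounds[of V V x 0 1] val by auto
    qed
  qed (use v_cont v_aff in auto)

  define I where "I u x = a x (u x) (grad u x) \<bullet> grad v x + b x (u x) * v x" for u x
  have int: "set_integrable lebesgue \<Omega> (I u1)" "set_integrable lebesgue \<Omega> (I u2)"
    using sub super \<open>v \<in> P1_plus \<T> \<Omega> (Gamma ED)\<close>
    unfolding discrete_subsolution_def discrete_supersolution_def residual_integrable_def I_def by blast+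
  have "residual \<Omega> (boundary_edges \<T> \<Omega> - ED) a b \<psi> u1 v \<le> 0"
    "residual \<Omega> (boundary_edges \<T> \<Omega> - ED) a b \<psi> u2 v \<ge> 0"
    using sub super \<open>v \<in> P1_plus \<T> \<Omega> (Gamma ED)\<close>
    unfolding discrete_subsolution_def discrete_supersolution_def by blast+
  \<comment> \<open>The Neumann term depends only on \<open>\<psi>\<close> and \<open>v\<close>, so
    it is the same in both residuals and cancels.\<close>
  then have "(LINT x:\<Omega>|lebesgue. I u1 x) \<le> (LINT x:\<Omega>|lebesgue. I u2 x)"
    unfolding residual_def I_def by linarith
  then have int_le: "(LINT x:\<Omega>|lebesgue. I u1 x - I u2 x) \<le> 0"
    using set_integral_diff(2)[OF int] by simp

  define mixed where "mixed V \<longleftrightarrow> (\<exists>y\<in>V. u1 y > u2 y) \<and> (\<exists>y\<in>V. \<not> u1 y > u2 y)" for V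
  have v_not_mixed: "(\<forall>x\<in>convex hull V. v x = 1 \<and> u1 x \<ge> u2 x) \<or> (\<forall>x\<in>convex hull V. v x = 0 \<and> u1 x \<le> u2 x)"
    if V: "V \<in> \<T>" and nm: "\<not> mixed V" for V
  proof -
    obtain w1 c1 w2 c2 where u: "\<forall>x\<in>convex hull V. u1 x = w1 \<bullet> x + c1" "\<forall>x\<in>convex hull V. u2 x = w2 \<bullet> x + c2"
      using P1 V unfolding P1_space_def by blast
    have hull: "y \<in> convex hull V" if "y \<in> V" for y
      using that by (rule hull_inc)
    consider "\<forall>y\<in>V. u1 y > u2 y" | "\<forall>y\<in>V. u1 y \<le> u2 y"
      using nm unfolding mixed_def not_less[symmetric] by blast
    then show ?thesis
    proof cases
      case 1
      then have "0 \<le> (w1 - w2) \<bullet> x + (c1 - c2)" if "x \<in> convex hull V" for x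
        using u hull by (intro affine_ge_on_hull[OF _ that]) (force simp: inner_diff_left)
      moreover have "v x = 1" if "x \<in> convex hull V" for x
        using v_const[OF V order_refl that] val[OF V] 1 by auto
      ultimately show ?thesis
        using u by (auto simp: inner_diff_left algebra_simps)
    next
      case 2
      then have "0 \<le> (w2 - w1) \<bullet> x + (c2 - c1)" if "x \<in> convex hull V" for x
        using u hull by (intro affine_ge_on_hull[OF _ that]) (force simp: inner_diff_left)
      moreover have "v x = 0" if "x \<in> convex hull V" for x
        using v_const[OF V order_refl that] val[OF V] 2 by fastforce
      ultimately show ?thesis
        using u by (auto simp: inner_diff_left algebra_simps)
    qed
  qed

  have pointwise: "AE x in lebesgue. \<forall>V\<in>\<T>. x \<in> interior (convex hull V) \<longrightarrow>
      I u1 x - I u2 x \<ge> 0 \<and> (mixed V \<longrightarrow> I u1 x - I u2 x > 0)"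
    using S A_bounds
  proof eventually_elim
    case (elim x)
    show ?case
    proof (intro ballI impI)
      fix V assume V: "V \<in> \<T>" and x: "x \<in> interior (convex hull V)"
      then have x\<Omega>: "x \<in> \<Omega>" and xV: "x \<in> convex hull V"
        using hull_\<Omega> interior_subset by blast+
      note S_x = mp[OF elim(1) x\<Omega>, THEN conjunct2, THEN conjunct2, rule_format]
      note A_x = mp[OF elim(2) x\<Omega>]
      have b_deriv: "(b x has_real_derivative b_eta x \<eta>) (at \<eta>)" "0 \<le> b_eta x \<eta>" "b_eta x \<eta> \<le> B_eta" for \<eta>
        using S_x by blast+
      have A_deriv: "((\<lambda>s. A x s \<xi>) has_real_derivative A_eta x \<eta> \<xi>) (at \<eta>)" "\<bar>A_eta x \<eta> \<xi>\<bar> \<le> K_eta" for \<eta> \<xi>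
        using S_x by blast+
      obtain w1 c1 w2 c2 where u: "\<forall>x\<in>convex hull V. u1 x = w1 \<bullet> x + c1" "\<forall>x\<in>convex hull V. u2 x = w2 \<bullet> x + c2"
        using P1 V unfolding P1_space_def by blast
      obtain wv cv where wv: "\<forall>x\<in>convex hull V. v x = wv \<bullet> x + cv"
        using v_aff V by blast
      have grads: "grad u1 x = w1" "grad u2 x = w2" "grad v x = wv"
        using u wv by (auto intro!: grad_affine[OF x])
      have diff_eq: "I u1 x - I u2 x =
          (A x (u1 x) w1 *\<^sub>R w1 - A x (u2 x) w2 *\<^sub>R w2) \<bullet> wv + (b x (u1 x) - b x (u2 x)) * v x"
        unfolding I_def a_def grads by (simp add: inner_diff_left algebra_simps)
      show "I u1 x - I u2 x \<ge> 0 \<and> (mixed V \<longrightarrow> I u1 x - I u2 x > 0)"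
      proof (cases "mixed V")
        case False
        have "I u1 x - I u2 x \<ge> 0"
          using v_not_mixed[OF V False]
        proof
          \<comment> \<open>The diffusion part disappears with the gradient of \<open>v\<close>, and
            monotonicity of \<open>b\<close> settles the rest.\<close>
          assume *: "\<forall>x\<in>convex hull V. v x = 1 \<and> u1 x \<ge> u2 x"
          then have "grad v x = 0"
            by (intro grad_affine[OF x, where c = 1]) auto
          moreover have "b x (u2 x) \<le> b x (u1 x)"
          proof (rule DERIV_nonneg_imp_nondecreasing[where f = "b x"])
            show "u2 x \<le> u1 x"
              using * xV by blast
            show "\<exists>y. (b x has_real_derivative y) (at t) \<and> 0 \<le> y" for t
              using b_deriv(1,2) by blast
          qed
          ultimately show ?thesis
            using * xV grads diff_eq by simp
        next
          assume *: "\<forall>x\<in>convex hull V. v x = 0 \<and> u1 x \<le> u2 x"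
          then have "grad v x = 0"
            by (intro grad_affine[OF x, where c = 0]) auto
          then show ?thesis
            using * xV grads diff_eq by simp
        qed
        then show ?thesis
          using False by simp
      next
        case True
        \<comment> \<open>The coefficient with its second argument frozen at \<open>u1 x\<close>,
          leaving a radial function of the gradient; the passage to \<open>u2 x\<close> is left to
          \<open>A_lip\<close>.\<close>
        define F where "F s = A0 x (u1 x) + A1 x (u1 x) * f s + A2 x * g s" for s
        define F' where "F' s = A1 x (u1 x) * f' s + A2 x * g' s" for s
        have F_eq: "A x (u1 x) \<xi> = F (norm \<xi>)" for \<xi>
          using A_struct by (simp add: F_def)
        have A1: "0 \<le> A1 x (u1 x)" "A1 x (u1 x) \<le> Lam1" and A2: "0 \<le> A2 x" "A2 x \<le> Lam2"
          and A0: "A0 x (u1 x) \<ge> lam0"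
          using A_x by auto
        have deriv: "(F has_real_derivative F' s) (at s within {0..})" if "s \<ge> 0" for s
        proof -
          have "(f has_real_derivative f' s) (at s within {0..})" "(g has_real_derivative g' s) (at s within {0..})"
            using fg that by blast+
          from DERIV_add[OF DERIV_add[OF DERIV_const DERIV_cmult[OF this(1)]] DERIV_cmult[OF this(2)]]
          show ?thesis
            unfolding F_def F'_def by simp
        qed
        have F_ge: "F s \<ge> lam0" if "s \<ge> 0" for s
        proof -
          have "A1 x (u1 x) * f s \<ge> 0" "A2 x * g s \<ge> 0"
            using fg[rule_format, OF that] A1(1) A2(1) by simp_all
          then show ?thesis
            using A0 unfolding F_def by linarith
        qed
        have F'_le: "s * \<bar>F' s\<bar> \<le> Lam1 * Cf + Lam2 * Cg" if "s \<ge> 0" for s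
        proof -
          have "s * \<bar>F' s\<bar> \<le> s * (A1 x (u1 x) * \<bar>f' s\<bar> + A2 x * \<bar>g' s\<bar>)"
            unfolding F'_def using that A1 A2 abs_triangle_ineq[of "A1 x (u1 x) * f' s" "A2 x * g' s"]
            by (intro mult_left_mono) (auto simp: abs_mult)
          also have "\<dots> = A1 x (u1 x) * (s * \<bar>f' s\<bar>) + A2 x * (s * \<bar>g' s\<bar>)"
            by (simp add: algebra_simps)
          also have "\<dots> \<le> Lam1 * Cf + Lam2 * Cg"
            using A1 A2 fg[rule_format, OF that] that consts_A by (intro add_mono mult_mono) simp_all
          finally show ?thesis .
        qed
        have acute: "cos (angle_of V p) \<ge> 0" if "p \<in> V" for p
        proof -
          have "t_min \<le> angle_of V p" "angle_of V p \<le> t_max"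
            using angles(4) V that by auto
          then show ?thesis
            using angles(1,3) by (intro cos_ge_zero) auto
        qed
        have b_lip: "\<bar>b x (u1 x) - b x (u2 x)\<bar> \<le> B_eta * \<bar>u1 x - u2 x\<bar>"
        proof (rule real_lipschitz_of_bounded_deriv)
          show "(b x has_real_derivative b_eta x t) (at t)" for t
            by (rule b_deriv)
          show "\<bar>b_eta x t\<bar> \<le> B_eta" for t
            using b_deriv(2,3)[of t] by linarith
        qed
        have A_lip: "\<bar>F (norm w2) - A x (u2 x) w2\<bar> \<le> K_eta * \<bar>u1 x - u2 x\<bar>"
          using real_lipschitz_of_bounded_deriv[of "\<lambda>s. A x s w2", OF A_deriv] by (simp flip: F_eq)
        have "min (lam0 * c_T V - Lam1 * Cf - Lam2 * Cg) (gam_a / r_T V)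
            - delta_T V u2 * (7 * K_eta * (1 + 1 / r_T V) / 6)
            - 7 * B_eta * area_T V * s_T V / 3 > 0"
          using cond V fin by (subst (asm) Min_gr_iff) auto
        then have cond_V: "lam0 * c_T V - (Lam1 * Cf + Lam2 * Cg)
            - delta_T V u2 * (7 * K_eta * (1 + 1 / r_T V) / 6) - 7 * B_eta * area_T V * s_T V / 3 > 0"
          by linarith
        have "(F (norm w1) *\<^sub>R w1 - A x (u2 x) w2 *\<^sub>R w2) \<bullet> wv + (b x (u1 x) - b x (u2 x)) * v x > 0"
          by (rule mixed_triangle_interpolant_integrand_pos[OF tri[OF V] acute deriv F_ge F'_le
                less_imp_le[OF consts_A(1)] u[rule_format] wv[rule_format] val[OF V] _ _ xV A_lip
                less_imp_le[OF consts_S(2)] b_lip consts_S(3) cond_V])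
            (use True in \<open>auto simp: mixed_def\<close>)
        then show ?thesis
          unfolding diff_eq F_eq by simp
      qed
    qed
  qed

  define J where "J x = indicat_real \<Omega> x *\<^sub>R (I u1 x - I u2 x)" for x
  have "integrable lebesgue J"
    using set_integral_diff(1)[OF int] unfolding set_integrable_def J_def .
  moreover have J_nonneg: "AE x in lebesgue. 0 \<le> J x"
    using pointwise triangulates_AE_interior[OF mesh]
    by eventually_elim (auto simp: J_def indicator_def)
  \<comment> \<open>The integral is at most zero by subtracting the two inequalities and at least
    zero by the pointwise sign.\<close>
  moreover have "integral\<^sup>L lebesgue J = 0"
    using int_le integral_nonneg_AE[OF J_nonneg] unfolding set_lebesgue_integral_def J_def by simp
  ultimately have J0: "AE x in lebesgue. J x = 0"
    using integral_nonneg_eq_0_iff_AE by blast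
  \<comment> \<open>On a mixed triangle \<open>J\<close> would be positive almost everywhere in a
    nonempty open set, which is not negligible.\<close>
  have no_mixed: "\<not> mixed V" if V: "V \<in> \<T>" for V
  proof
    assume "mixed V"
    have "AE x in lebesgue. x \<notin> interior (convex hull V)"
      using pointwise J0
      by eventually_elim (use V \<open>mixed V\<close> hull_\<Omega>[OF V] in \<open>fastforce simp: J_def\<close>)
    then have "negligible (interior (convex hull V))"
      by (simp add: negligible_iff_null_sets AE_iff_null_sets)
    then show False
      using open_not_negligible[OF open_interior is_triangle_interior_hull[OF tri[OF V]]] by blast
  qed

  obtain e where e: "e \<in> ED"
    using dirichlet(2) by blast
  then have "card e = 2" "\<exists>V\<in>\<T>. e \<subseteq> V"
    using dirichlet(1) by (auto simp: boundary_edges_def)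
  then obtain V0 y0 where V0: "V0 \<in> \<T>" "e \<subseteq> V0" "y0 \<in> e"
    by fastforce
  \<comment> \<open>A finite connected set of reals has at most one element; the end
    \<open>y0\<close> of a Dirichlet edge shows that this element is \<open>0\<close>.\<close>
  have "connected (v ` ?K)"
    using connected_imp_connected_closure[OF dom(3)] v_cont unfolding clo
    by (rule connected_continuous_image[rotated])
  moreover have "v ` ?K \<subseteq> {0, 1}"
    using v_not_mixed no_mixed by blast
  then have "finite (v ` ?K)"
    using finite_subset by blast
  ultimately have "v ` ?K = {} \<or> (\<exists>m. v ` ?K = {m})"
    by (simp add: connected_finite_iff_sing)
  moreover have "y0 \<in> ?K"
  proof
    show "y0 \<in> convex hull V0"
      using V0 by (auto intro: hull_inc)
  qed (rule V0(1))
  moreover have "v y0 = 0"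
    using v0[OF e hull_inc[OF V0(3)]] .
  ultimately have "v ` ?K = {0}"
    by (metis empty_iff image_eqI singletonD)
  then have v_zero: "v x = 0" if "x \<in> ?K" for x
    using imageI[OF that, of v] by simp
  \<comment> \<open>Since \<open>v\<close> vanishes everywhere, each triangle falls under the second
    alternative of \<open>v_not_mixed\<close>, which carries the desired inequality.\<close>
  show "\<forall>x\<in>\<Omega>. u1 x \<le> u2 x"
  proof
    fix x assume "x \<in> \<Omega>"
    then obtain V where V: "V \<in> \<T>" "x \<in> convex hull V"
      using clo closure_subset by blast
    then show "u1 x \<le> u2 x"
      using v_not_mixed[OF V(1) no_mixed[OF V(1)]] v_zero[of x] by force
  qed
qed

end
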